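(* The spectrum of $L_0$ is simple and $\sigma(L_0)=\{\pm\lambda_k^3(0): k\in\mathbb N\}$, where $0<\lambda_1(0)<\lambda_2(0)<\dots$ are the positive zeros of $\Delta(0,\cdot)$. For $\lambda\in\{\lambda_k(0),-\lambda_k(0)\}$ the function $$x\mapsto s(i\lambda x)s(i\lambda l)+d(i\lambda x)\,[1-c(i\lambda l)]$$ is not identically zero and spans the eigenspace of $L_0$ for the eigenvalue $\lambda^3$; dividing it by its $L^2(0,l)$-norm gives the normalized eigenfunction $u(0,\lambda,x)$.
   Context: Let $\zeta_1=1$, $\zeta_2=-\frac12+\frac{\sqrt3}{2}i$, $\zeta_3=-\frac12-\frac{\sqrt3}{2}i$. For $z\in\mathbb C$ let $c(z)=\frac13\sum_{k=1}^3 e^{z\zeta_k}$, $s(z)=\frac13\sum_{k=1}^3\zeta_k^{-1}e^{z\zeta_k}$, $d(z)=\frac13\sum_{k=1}^3\zeta_k^{-2}e^{z\zeta_k}$. Fix $0<l<\infty$. $L_0$ is the operator in $L^2(0,l)$ given by $(L_0y)(x)=iy'''(x)$ with domain $\{y\in W^{3,2}(0,l): y(0)=0,\ y'(0)=y'(l),\ y(l)=0\}$ (it is self-adjoint). The characteristic function of $L_0$ is $\Delta(0,\lambda)=\lambda^{-2}\big(s^2(i\lambda l)+d(i\lambda l)(1-c(i\lambda l))\big)=\lambda^{-2}\big(d(i\lambda l)+d(-i\lambda l)\big)$ for $\lambda\neq0$, extended by continuity at $0$. *)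

theory Defs
  imports "HOL-Analysis.Analysis"
begin

definition zeta :: "nat \<Rightarrow> complex" where
  "zeta k = (if k = 1 then 1
             else if k = 2 then Complex (-1/2) (sqrt 3 / 2)
             else Complex (-1/2) (- sqrt 3 / 2))"

definition cfun :: "complex \<Rightarrow> complex" where
  "cfun z = (1/3) * (\<Sum>k\<in>{1,2,3}. exp (z * zeta k))"

definition sfun :: "complex \<Rightarrow> complex" where
  "sfun z = (1/3) * (\<Sum>k\<in>{1,2,3}. inverse (zeta k) * exp (z * zeta k))"

definition dfun :: "complex \<Rightarrow> complex" where
  "dfun z = (1/3) * (\<Sum>k\<in>{1,2,3}. inverse (zeta k ^ 2) * exp (z * zeta k))"

definition Delta0_raw :: "real \<Rightarrow> complex \<Rightarrow> complex" where
  "Delta0_raw l w = (sfun (\<i> * w * of_real l) ^ 2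
      + dfun (\<i> * w * of_real l) * (1 - cfun (\<i> * w * of_real l))) / w ^ 2"

definition Delta0 :: "real \<Rightarrow> complex \<Rightarrow> complex" where
  "Delta0 l w = (if w = 0 then Lim (at 0) (Delta0_raw l) else Delta0_raw l w)"

definition L2 :: "real \<Rightarrow> (real \<Rightarrow> complex) \<Rightarrow> bool" where
  "L2 l f \<longleftrightarrow> f \<in> borel_measurable (lebesgue_on {0..l})
      \<and> integrable (lebesgue_on {0..l}) (\<lambda>x. (cmod (f x))^2)"

definition L2norm :: "real \<Rightarrow> (real \<Rightarrow> complex) \<Rightarrow> real" where
  "L2norm l f = sqrt (integral\<^sup>L (lebesgue_on {0..l}) (\<lambda>x. (cmod (f x))^2))"

text \<open>y belongs to W^{3,2}(0,l) with first, second derivatives y1, y2 and (a.e.)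
  third derivative g: y, y1 are differentiable on [0,l], y2 is absolutely continuous,
  being the indefinite integral of g, and g is in L^2(0,l).\<close>
definition W32 :: "real \<Rightarrow> (real \<Rightarrow> complex) \<Rightarrow> (real \<Rightarrow> complex)
     \<Rightarrow> (real \<Rightarrow> complex) \<Rightarrow> (real \<Rightarrow> complex) \<Rightarrow> bool" where
  "W32 l y y1 y2 g \<longleftrightarrow>
     (\<forall>x\<in>{0..l}. (y has_vector_derivative y1 x) (at x within {0..l}))
   \<and> (\<forall>x\<in>{0..l}. (y1 has_vector_derivative y2 x) (at x within {0..l}))
   \<and> L2 l g
   \<and> (\<forall>x\<in>{0..l}. y2 x = y2 0 + integral\<^sup>L (lebesgue_on {0..x}) g)"

text \<open>is_L0 l y f: y is in the domain of L_0 and L_0 y = f (as elements of L^2(0,l)).\<close>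
definition is_L0 :: "real \<Rightarrow> (real \<Rightarrow> complex) \<Rightarrow> (real \<Rightarrow> complex) \<Rightarrow> bool" where
  "is_L0 l y f \<longleftrightarrow> (\<exists>y1 y2 g. W32 l y y1 y2 g
      \<and> y 0 = 0 \<and> y1 0 = y1 l \<and> y l = 0
      \<and> (AE x in lebesgue_on {0..l}. \<i> * g x = f x))"

text \<open>Resolvent set and spectrum of L_0: mu is in the resolvent set iff L_0 - mu maps
  the domain onto L^2(0,l) and has a bounded inverse.\<close>
definition resolvent_L0 :: "real \<Rightarrow> complex set" where
  "resolvent_L0 l = {\<mu>.
     (\<forall>f. L2 l f \<longrightarrow> (\<exists>y. is_L0 l y (\<lambda>x. f x + \<mu> * y x)))
   \<and> (\<exists>C::real. \<forall>y h. is_L0 l y h \<longrightarrow> L2norm l y \<le> C * L2norm l (\<lambda>x. h x - \<mu> * y x))}"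

definition spec_L0 :: "real \<Rightarrow> complex set" where
  "spec_L0 l = - resolvent_L0 l"

definition eigfun :: "real \<Rightarrow> real \<Rightarrow> real \<Rightarrow> complex" where
  "eigfun l t x = sfun (\<i> * of_real t * of_real x) * sfun (\<i> * of_real t * of_real l)
      + dfun (\<i> * of_real t * of_real x) * (1 - cfun (\<i> * of_real t * of_real l))"

end

theory Submission
  imports Defs "HOL-Complex_Analysis.Complex_Analysis"
begin

text \<open>For \<open>m = - i \<mu>\<close> let \<open>C, S, D\<close> be the solutions of \<open>y''' = m y\<close> whose jets at 0 are the unit
  vectors. Imposing the boundary conditions on \<open>b S + e D\<close> gives a linear system for \<open>(b, e)\<close> with
  determinant \<open>S(l)\<^sup>2 + D(l) (1 - C(l))\<close>. If it is nonzero, variation of constants produces a bounded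
  inverse of \<open>L\<^sub>0 - \<mu>\<close>; if it vanishes, \<open>\<mu>\<close> is an eigenvalue, which is real by symmetry of \<open>L\<^sub>0\<close>.
  For \<open>\<mu> = t\<^sup>3\<close> with \<open>t\<close> real the determinant is \<open>-\<Delta>(0,t)\<close>, a real function of \<open>t\<close> that alternates
  in sign at the points \<open>2 \<pi> n / l\<close> and extends holomorphically, so its zeros are infinite in number
  and do not accumulate. Eigenvalues are simple because \<open>S(l) = 0\<close> and \<open>C(l) = 1\<close> together would
  force \<open>exp (i t l \<zeta>\<^sub>2) = 1\<close>, contradicting its modulus.\<close>

section \<open>Square-integrable functions\<close>

lemma L2_continuous:
  assumes "continuous_on {0..l} f"
  shows "L2 l f"
  unfolding L2_def using assms
  by (auto intro!: continuous_imp_measurable_on_sets_lebesgue continuous_imp_integrable_real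
      continuous_intros)

lemma L2_cmult:
  assumes "L2 l f"
  shows "L2 l (\<lambda>x. c * f x)"
  using assms unfolding L2_def by (auto simp: norm_mult power_mult_distrib)

lemma L2_add:
  assumes "L2 l f" "L2 l g"
  shows "L2 l (\<lambda>x. f x + g x)"
proof -
  have [measurable]: "f \<in> borel_measurable (lebesgue_on {0..l})" "g \<in> borel_measurable (lebesgue_on {0..l})"
    using assms by (auto simp: L2_def)
  have "integrable (lebesgue_on {0..l}) (\<lambda>x. (cmod (f x + g x))^2)"
  proof (rule Bochner_Integration.integrable_bound)
    show "integrable (lebesgue_on {0..l}) (\<lambda>x. 2 * (cmod (f x))^2 + 2 * (cmod (g x))^2)"
      using assms by (auto simp: L2_def)
    have "(cmod (f x + g x))^2 \<le> 2 * (cmod (f x))^2 + 2 * (cmod (g x))^2" for x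
    proof -
      have "(cmod (f x + g x))^2 \<le> (cmod (f x) + cmod (g x))^2"
        by (intro power_mono norm_triangle_ineq) auto
      also have "\<dots> \<le> 2 * (cmod (f x))^2 + 2 * (cmod (g x))^2"
        using sum_squares_bound[of "cmod (f x)" "cmod (g x)"] by (simp add: power2_sum)
      finally show ?thesis .
    qed
    then show "AE x in lebesgue_on {0..l}. norm ((cmod (f x + g x))^2)
        \<le> norm (2 * (cmod (f x))^2 + 2 * (cmod (g x))^2)"
      by (intro AE_I2) (simp add: order_trans[OF _ abs_ge_self])
  qed measurable
  then show ?thesis
    by (auto simp: L2_def)
qed

lemma L2_integrable:
  assumes "L2 l f"
  shows "integrable (lebesgue_on {0..l}) f"
proof (rule Bochner_Integration.integrable_bound)
  show "integrable (lebesgue_on {0..l}) (\<lambda>x. 1 + (cmod (f x))^2)"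
    using assms by (auto simp: L2_def)
  have "cmod (f x) \<le> 1 + (cmod (f x))^2" for x
    using sum_squares_bound[of 1 "cmod (f x)"] norm_ge_zero[of "f x"] by (simp, linarith)
  then show "AE x in lebesgue_on {0..l}. cmod (f x) \<le> norm (1 + (cmod (f x))^2)"
    by (intro AE_I2) (simp add: order_trans[OF _ abs_ge_self])
qed (use assms in \<open>auto simp: L2_def\<close>)

lemma L2norm_nonneg: "0 \<le> L2norm l f"
  unfolding L2norm_def by simp

lemma L2norm_eq_0_iff_continuous:
  assumes "0 < l" "continuous_on {0..l} f"
  shows "L2norm l f = 0 \<longleftrightarrow> (\<forall>x\<in>{0..l}. f x = 0)"
  using assms unfolding L2norm_def
  by (subst real_sqrt_eq_0_iff, subst integralL_eq_0_iff) (auto intro!: continuous_intros)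

lemma L2norm_le_sup:
  assumes "0 < l" "continuous_on {0..l} f" "\<And>x. x \<in> {0..l} \<Longrightarrow> cmod (f x) \<le> B"
  shows "L2norm l f \<le> sqrt l * B"
proof -
  have B: "0 \<le> B"
    using assms(1) order_trans[OF norm_ge_zero assms(3)[of 0]] by simp
  have "integral\<^sup>L (lebesgue_on {0..l}) (\<lambda>x. (cmod (f x))^2)
      \<le> integral\<^sup>L (lebesgue_on {0..l}) (\<lambda>x. B^2)"
    using L2_continuous[OF assms(2)] assms(3)
    by (intro integral_mono) (auto simp: L2_def intro!: power_mono)
  also have "\<dots> = l * B^2"
    using assms(1) by (simp add: measure_restrict_space)
  finally have "L2norm l f \<le> sqrt (l * B^2)"
    unfolding L2norm_def by (rule real_sqrt_le_mono)
  then show ?thesis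
    using B by (simp add: real_sqrt_mult)
qed

text \<open>Cauchy-Schwarz against the constant 1, read off from the nonnegativity of the variance
  of \<open>cmod (f x)\<close>.\<close>

lemma L1_le_L2norm:
  assumes "0 < l" "L2 l f"
  shows "integral\<^sup>L (lebesgue_on {0..l}) (\<lambda>x. cmod (f x)) \<le> sqrt l * L2norm l f"
proof -
  define I where "I = integral\<^sup>L (lebesgue_on {0..l}) (\<lambda>x. cmod (f x))"
  define J where "J = integral\<^sup>L (lebesgue_on {0..l}) (\<lambda>x. (cmod (f x))^2)"
  have i1: "integrable (lebesgue_on {0..l}) (\<lambda>x. cmod (f x))"
    using L2_integrable[OF assms(2)] by simp
  have i2: "integrable (lebesgue_on {0..l}) (\<lambda>x. (cmod (f x))^2)"
    using assms(2) by (simp add: L2_def)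
  \<comment> \<open>The mean value of \<open>cmod (f x)\<close>; it minimises the integral below,
    whose value is then \<open>J - I^2 / l\<close>.\<close>
  define a where "a = I / l"
  have "0 \<le> integral\<^sup>L (lebesgue_on {0..l}) (\<lambda>x. (cmod (f x) - a)^2)"
    by simp
  also have "\<dots> = integral\<^sup>L (lebesgue_on {0..l}) (\<lambda>x. ((cmod (f x))^2 - (2 * a) * cmod (f x)) + a^2)"
    by (rule Bochner_Integration.integral_cong) (auto simp: power2_diff)
  also have "\<dots> = J - 2 * a * I + l * a^2"
    using i1 i2 assms(1) by (simp add: I_def J_def measure_restrict_space)
  also have "\<dots> = J - I^2 / l"
    using assms(1) by (simp add: a_def field_simps power2_eq_square)
  finally have "I^2 \<le> l * J"
    using assms(1) by (simp add: field_simps)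
  then have "I \<le> sqrt (l * J)"
    by (rule real_le_rsqrt)
  then show ?thesis
    by (simp add: I_def J_def L2norm_def real_sqrt_mult)
qed

lemma AE_lebesgue_on_subset:
  assumes "AE x in lebesgue_on S. P x" "T \<subseteq> S" "S \<in> sets lebesgue" "T \<in> sets lebesgue"
  shows "AE x in lebesgue_on T. P x"
  using assms by (subst (asm) AE_restrict_space_iff, simp, subst AE_restrict_space_iff, auto)

text \<open>Rests on completeness of Lebesgue measure; extending by zero moves the question from
  \<open>S\<close> to the whole line.\<close>

lemma borel_measurable_lebesgue_on_AE:
  fixes f g :: "real \<Rightarrow> complex"
  assumes "f \<in> borel_measurable (lebesgue_on S)" "AE x in lebesgue_on S. f x = g x" "S \<in> sets lebesgue"
  shows "g \<in> borel_measurable (lebesgue_on S)"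
proof -
  have "(\<lambda>x. if x \<in> S then g x else 0) \<in> borel_measurable lebesgue"
  proof (rule borel_measurable_AE)
    show "(\<lambda>x. if x \<in> S then f x else 0) \<in> borel_measurable lebesgue"
      using assms borel_measurable_if by blast
    have "AE x in lebesgue. x \<in> S \<longrightarrow> f x = g x"
      using assms by (subst (asm) AE_restrict_space_iff) auto
    then show "AE x in lebesgue. (if x \<in> S then f x else 0) = (if x \<in> S then g x else 0)"
      by eventually_elim auto
  qed
  then show ?thesis
    using assms(3) borel_measurable_if by blast
qed

text \<open>Needed because \<open>is_L0\<close> determines the image only up to a null set, so
  membership of the image in L^2 has to be inherited from an equivalent function.\<close>

lemma L2_cong_AE:
  assumes "L2 l f" "AE x in lebesgue_on {0..l}. f x = g x"
  shows "L2 l g" and "L2norm l f = L2norm l g"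
proof -
  have f[measurable]: "f \<in> borel_measurable (lebesgue_on {0..l})"
    using assms by (simp add: L2_def)
  then have g[measurable]: "g \<in> borel_measurable (lebesgue_on {0..l})"
    by (rule borel_measurable_lebesgue_on_AE) (use assms in auto)
  have AE: "AE x in lebesgue_on {0..l}. (cmod (f x))^2 = (cmod (g x))^2"
    using assms(2) by eventually_elim auto
  have "integrable (lebesgue_on {0..l}) (\<lambda>x. (cmod (g x))^2)"
    by (rule integrable_cong_AE_imp[OF _ _ AE]) (use assms in \<open>auto simp: L2_def\<close>)
  then show "L2 l g"
    by (simp add: L2_def)
  show "L2norm l f = L2norm l g"
    unfolding L2norm_def by (intro arg_cong[where f=sqrt] integral_cong_AE AE) measurable
qed

section \<open>Primitives of square-integrable functions\<close>

definition prim :: "(real \<Rightarrow> complex) \<Rightarrow> real \<Rightarrow> complex" where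
  "prim f x = integral\<^sup>L (lebesgue_on {0..x}) f"

lemma integrable_initial:
  assumes "L2 l f" "x \<in> {0..l}"
  shows "integrable (lebesgue_on {0..x}) f"
  using integrable_subinterval[OF L2_integrable[OF assms(1)]] assms(2) by auto

text \<open>Bridge from the Lebesgue integral that appears in \<open>W32\<close> to the gauge
  integral, in which the fundamental theorem of calculus is stated.\<close>

lemma prim_eq_integral:
  assumes "L2 l f" "x \<in> {0..l}"
  shows "prim f x = integral {0..x} f"
  unfolding prim_def by (intro lebesgue_integral_eq_integral integrable_initial[OF assms]) auto

lemma prim_0 [simp]: "prim f 0 = 0"
  unfolding prim_def by (rule integral_eq_zero_null_sets) auto

lemma prim_add:
  assumes "L2 l f" "L2 l g" "x \<in> {0..l}"
  shows "prim (\<lambda>x. f x + g x) x = prim f x + prim g x"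
  unfolding prim_def using assms by (intro Bochner_Integration.integral_add integrable_initial)

lemma prim_cmult: "prim (\<lambda>x. c * f x) x = c * prim f x"
  unfolding prim_def by simp

lemma prim_cong_AE:
  assumes "L2 l f" "AE x in lebesgue_on {0..l}. f x = g x" "x \<in> {0..l}"
  shows "prim f x = prim g x"
  unfolding prim_def
proof (rule integral_cong_AE)
  have "L2 l g"
    using L2_cong_AE assms by blast
  then show "f \<in> borel_measurable (lebesgue_on {0..x})" "g \<in> borel_measurable (lebesgue_on {0..x})"
    using integrable_initial assms borel_measurable_integrable by blast+
  show "AE x in lebesgue_on {0..x}. f x = g x"
    using AE_lebesgue_on_subset[OF assms(2)] assms(3) by auto
qed

lemma continuous_on_prim:
  assumes "L2 l f"
  shows "continuous_on {0..l} (prim f)"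
proof -
  have "f integrable_on {0..l}"
    by (rule integrable_on_lebesgue_on[OF L2_integrable[OF assms]]) auto
  then have "continuous_on {0..l} (\<lambda>x. integral {0..x} f)"
    by (rule indefinite_integral_continuous_1)
  then show ?thesis
    by (rule continuous_on_eq) (simp add: prim_eq_integral[OF assms])
qed

text \<open>Controls the continuous forcing term of the first-order system by the
  \<open>L2norm\<close> of the right-hand side, so that sup-norm estimates yield a bounded inverse
  on L^2.\<close>

lemma norm_prim_le:
  assumes "0 < l" "L2 l f" "x \<in> {0..l}"
  shows "cmod (prim f x) \<le> sqrt l * L2norm l f"
proof -
  have "cmod (prim f x) \<le> integral\<^sup>L (lebesgue_on {0..x}) (\<lambda>x. cmod (f x))"
    unfolding prim_def by (rule integral_norm_bound)
  also have "\<dots> \<le> integral\<^sup>L (lebesgue_on {0..l}) (\<lambda>x. cmod (f x))"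
    using assms(3) L2_integrable[OF assms(2)]
    by (intro integral_mono_lebesgue_on_AE) auto
  also have "\<dots> \<le> sqrt l * L2norm l f"
    by (rule L1_le_L2norm[OF assms(1,2)])
  finally show ?thesis .
qed

lemma prim_has_vector_derivative:
  assumes "continuous_on {0..l} f" "x \<in> {0..l}"
  shows "(prim f has_vector_derivative f x) (at x within {0..l})"
proof -
  have "((\<lambda>x. integral {0..x} f) has_vector_derivative f x) (at x within {0..l})"
    by (rule integral_has_vector_derivative[OF assms])
  then show ?thesis
    by (rule has_vector_derivative_transform[OF assms(2), rotated])
      (use prim_eq_integral[OF L2_continuous[OF assms(1)]] in auto)
qed

section \<open>The boundary value problem as a first-order system\<close>

text \<open>The third derivative of a function in the domain exists only almost everywhere. Subtracting
  the primitive of the right-hand side from the second derivative gives a classical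
  \<open>C\<^sup>1\<close> system, with a continuous forcing term in its second equation.\<close>

definition forced_system :: "complex \<Rightarrow> real \<Rightarrow> (real \<Rightarrow> complex) \<Rightarrow>
    (real \<Rightarrow> complex) \<Rightarrow> (real \<Rightarrow> complex) \<Rightarrow> (real \<Rightarrow> complex) \<Rightarrow> bool" where
  "forced_system m l G y y1 z \<longleftrightarrow> (\<forall>x\<in>{0..l}.
      (y has_vector_derivative y1 x) (at x within {0..l})
    \<and> (y1 has_vector_derivative z x + G x) (at x within {0..l})
    \<and> (z has_vector_derivative m * y x) (at x within {0..l}))"

definition boundary :: "real \<Rightarrow> (real \<Rightarrow> complex) \<Rightarrow> (real \<Rightarrow> complex) \<Rightarrow> bool" where
  "boundary l y y1 \<longleftrightarrow> y 0 = 0 \<and> y1 0 = y1 l \<and> y l = 0"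

lemma forced_system_continuous:
  assumes "forced_system m l G y y1 z"
  shows "continuous_on {0..l} y" "continuous_on {0..l} y1" "continuous_on {0..l} z"
  using assms unfolding forced_system_def continuous_on_eq_continuous_within
  by (auto intro: has_vector_derivative_continuous)

lemma is_L0_imp_forced_system:
  fixes \<mu> :: complex
  assumes "is_L0 l y h"
  defines "f \<equiv> \<lambda>x. h x - \<mu> * y x"
  shows "L2 l f"
    and "\<exists>y1 z. forced_system (-\<i> * \<mu>) l (\<lambda>x. - \<i> * prim f x) y y1 z \<and> boundary l y y1"
proof -
  obtain y1 y2 g where W: "W32 l y y1 y2 g" and bc: "y 0 = 0" "y1 0 = y1 l" "y l = 0"
    and AE: "AE x in lebesgue_on {0..l}. \<i> * g x = h x"
    using assms(1) unfolding is_L0_def by blast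
  have dy: "(y has_vector_derivative y1 x) (at x within {0..l})"
    and dy1: "(y1 has_vector_derivative y2 x) (at x within {0..l})"
    and y2: "y2 x = y2 0 + prim g x" if "x \<in> {0..l}" for x
    using W that unfolding W32_def prim_def by blast+
  have g: "L2 l g"
    using W by (simp add: W32_def)
  have cy: "continuous_on {0..l} y"
    unfolding continuous_on_eq_continuous_within using dy has_vector_derivative_continuous by blast
  have my: "L2 l (\<lambda>x. c * y x)" for c
    by (intro L2_cmult L2_continuous cy)
  \<comment> \<open>A representative of \<open>f\<close> built from the third derivative
    \<open>g\<close>; it lies in L^2 by construction, and \<open>f\<close> equals it almost
    everywhere.\<close>
  define f' where "f' = (\<lambda>x. \<i> * g x + (-\<mu>) * y x)"
  have f': "L2 l f'"
    unfolding f'_def by (intro L2_add L2_cmult g my)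
  have ff': "AE x in lebesgue_on {0..l}. f' x = f x"
    using AE by eventually_elim (auto simp: f'_def f_def)
  show "L2 l f"
    by (rule L2_cong_AE[OF f' ff'])
  have pf: "prim f x = \<i> * prim g x - \<mu> * prim y x" if "x \<in> {0..l}" for x
  proof -
    have "prim f x = prim f' x"
      using prim_cong_AE[OF f' ff' that] by simp
    also have "\<dots> = prim (\<lambda>x. \<i> * g x) x + prim (\<lambda>x. (-\<mu>) * y x) x"
      unfolding f'_def by (rule prim_add[OF L2_cmult[OF g] my that])
    finally show ?thesis
      unfolding prim_cmult by simp
  qed
  \<comment> \<open>This is \<open>y2\<close> minus the forcing term: since \<open>prim f\<close> is
    \<open>\<i> * prim g - \<mu> * prim y\<close>, the contribution of \<open>g\<close> cancels and
    only the primitive of the continuous \<open>y\<close> remains.\<close>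
  define z where "z = (\<lambda>x. y2 0 + (-\<i> * \<mu>) * prim y x)"
  have "forced_system (-\<i> * \<mu>) l (\<lambda>x. - \<i> * prim f x) y y1 z"
    unfolding forced_system_def
  proof (intro ballI conjI)
    fix x assume x: "x \<in> {0..l}"
    show "(y has_vector_derivative y1 x) (at x within {0..l})"
      by (rule dy[OF x])
    have "z x + - \<i> * prim f x = y2 x"
      unfolding z_def y2[OF x] pf[OF x] by (simp add: algebra_simps)
    then show "(y1 has_vector_derivative z x + - \<i> * prim f x) (at x within {0..l})"
      using dy1[OF x] by simp
    have "(z has_vector_derivative 0 + (-\<i> * \<mu>) * y x) (at x within {0..l})"
      unfolding z_def
      by (intro has_vector_derivative_add has_vector_derivative_const has_vector_derivative_mult_right
          prim_has_vector_derivative cy x)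
    then show "(z has_vector_derivative (-\<i> * \<mu>) * y x) (at x within {0..l})"
      by simp
  qed
  then show "\<exists>y1 z. forced_system (-\<i> * \<mu>) l (\<lambda>x. - \<i> * prim f x) y y1 z \<and> boundary l y y1"
    using bc unfolding boundary_def by blast
qed

lemma forced_system_imp_is_L0:
  assumes f: "L2 l f"
    and sys: "forced_system (-\<i> * \<mu>) l (\<lambda>x. - \<i> * prim f x) y y1 z"
    and bc: "boundary l y y1"
  shows "is_L0 l y (\<lambda>x. f x + \<mu> * y x)"
proof -
  have cy: "continuous_on {0..l} y"
    using forced_system_continuous[OF sys] by blast
  have my: "L2 l (\<lambda>x. c * y x)" for c
    by (intro L2_cmult L2_continuous cy)
  \<comment> \<open>Obtained by solving \<open>\<i> * g x = f x + \<mu> * y x\<close> for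
    \<open>g\<close>; below, adding the forcing term back to \<open>z\<close> recovers the second
    derivative.\<close>
  define g where "g = (\<lambda>x. (-\<i>) * f x + (-\<i> * \<mu>) * y x)"
  define y2 where "y2 = (\<lambda>x. z x + - \<i> * prim f x)"
  have pg: "prim g x = - \<i> * prim f x + (-\<i> * \<mu>) * prim y x" if "x \<in> {0..l}" for x
    using prim_add[OF L2_cmult[OF f] my that] unfolding g_def prim_cmult by blast
  have z: "z x = z 0 + (-\<i> * \<mu>) * prim y x" if x: "x \<in> {0..l}" for x
  proof -
    have "((\<lambda>s. (-\<i> * \<mu>) * y s) has_integral z x - z 0) {0..x}"
    proof (rule fundamental_theorem_of_calculus)
      fix s assume "s \<in> {0..x}"
      then have "(z has_vector_derivative (-\<i> * \<mu>) * y s) (at s within {0..l})"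
        using sys x unfolding forced_system_def by auto
      then show "(z has_vector_derivative (-\<i> * \<mu>) * y s) (at s within {0..x})"
        by (rule has_vector_derivative_within_subset) (use x in auto)
    qed (use x in auto)
    then have "prim (\<lambda>s. (-\<i> * \<mu>) * y s) x = z x - z 0"
      using prim_eq_integral[OF my x] integral_unique by metis
    then show ?thesis
      unfolding prim_cmult by simp
  qed
  have "W32 l y y1 y2 g"
    unfolding W32_def
  proof (intro conjI ballI)
    show "L2 l g"
      unfolding g_def by (intro L2_add L2_cmult[OF f] my)
    fix x assume x: "x \<in> {0..l}"
    show "(y has_vector_derivative y1 x) (at x within {0..l})"
      "(y1 has_vector_derivative y2 x) (at x within {0..l})"
      using sys x unfolding forced_system_def y2_def by auto
    show "y2 x = y2 0 + integral\<^sup>L (lebesgue_on {0..x}) g"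
      using z[OF x] pg[OF x] by (simp add: y2_def flip: prim_def)
  qed
  moreover have "AE x in lebesgue_on {0..l}. \<i> * g x = f x + \<mu> * y x"
    by (intro AE_I2) (simp add: g_def algebra_simps)
  ultimately show ?thesis
    using bc unfolding is_L0_def boundary_def by blast
qed

text \<open>Derivatives within a nondegenerate closed interval are unique, so differentiating the
  zero function gives zero twice. Evaluated at 0, this reads off the coefficients of a vanishing
  combination of \<open>S\<close> and \<open>D\<close>.\<close>

lemma forced_system_zero:
  assumes sys: "forced_system m l (\<lambda>_. 0) y y1 z" and "0 < l" "\<forall>x\<in>{0..l}. y x = 0"
    and x: "x \<in> {0..l}"
  shows "y1 x = 0" "z x = 0"
proof -
  have *: "v x = 0"
    if d: "\<And>x. x \<in> {0..l} \<Longrightarrow> (u has_vector_derivative v x) (at x within {0..l})"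
      and u: "\<And>x. x \<in> {0..l} \<Longrightarrow> u x = 0" and x: "x \<in> {0..l}"
    for u v :: "real \<Rightarrow> complex" and x
  proof -
    have "(u has_vector_derivative 0) (at x within {0..l})"
      using has_vector_derivative_const[of 0 "at x within {0..l}"]
      by (rule has_vector_derivative_transform[OF x, rotated]) (use u in auto)
    then show ?thesis
      using vector_derivative_unique_within_closed_interval[of 0 l x u] d[OF x] x \<open>0 < l\<close> by auto
  qed
  have y1: "y1 x = 0" if "x \<in> {0..l}" for x
    using *[of y y1 x] assms(3) sys that unfolding forced_system_def by auto
  show "y1 x = 0"
    by (rule y1[OF x])
  show "z x = 0"
    using *[of y1 z x] y1 sys x unfolding forced_system_def by auto
qed

text \<open>Symmetry of the operator: \<open>z y\<^sup>* - y\<^sub>1 y\<^sub>1\<^sup>* + y z\<^sup>*\<close> has derivative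
  \<open>2 (Re m) |y|\<^sup>2\<close> and equal values at both end points.\<close>

lemma boundary_imp_Re_eq_0:
  assumes sys: "forced_system m l (\<lambda>_. 0) y y1 z" and bc: "boundary l y y1" and l: "0 < l"
    and nz: "\<exists>x\<in>{0..l}. y x \<noteq> 0"
  shows "Re m = 0"
proof -
  define Q where "Q = (\<lambda>x. z x * cnj (y x) - y1 x * cnj (y1 x) + y x * cnj (z x))"
  have dQ: "(Q has_vector_derivative of_real (2 * Re m) * (of_real ((cmod (y x))^2))) (at x within {0..l})"
    if x: "x \<in> {0..l}" for x
  proof -
    have d: "(y has_vector_derivative y1 x) (at x within {0..l})"
      "(y1 has_vector_derivative z x) (at x within {0..l})"
      "(z has_vector_derivative m * y x) (at x within {0..l})"
      using sys x unfolding forced_system_def by auto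
    have "(Q has_vector_derivative
        (z x * cnj (y1 x) + (m * y x) * cnj (y x)) - (y1 x * cnj (z x) + z x * cnj (y1 x))
        + (y x * cnj (m * y x) + y1 x * cnj (z x))) (at x within {0..l})"
      unfolding Q_def
      by (intro has_vector_derivative_add has_vector_derivative_diff has_vector_derivative_mult
          has_vector_derivative_cnj d)
    moreover have "(z x * cnj (y1 x) + (m * y x) * cnj (y x)) - (y1 x * cnj (z x) + z x * cnj (y1 x))
        + (y x * cnj (m * y x) + y1 x * cnj (z x)) = of_real (2 * Re m) * of_real ((cmod (y x))^2)"
      unfolding complex_norm_square complex_add_cnj[symmetric] by (simp add: algebra_simps)
    ultimately show ?thesis
      by simp
  qed
  have "((\<lambda>x. of_real (2 * Re m) * of_real ((cmod (y x))^2)) has_integral Q l - Q 0) {0..l}"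
    by (rule fundamental_theorem_of_calculus) (use l dQ in auto)
  \<comment> \<open>The terms containing \<open>y\<close> vanish at both ends; what is left is minus
    the squared modulus of \<open>y1\<close>, which agrees there because
    \<open>y1 0 = y1 l\<close>.\<close>
  moreover have "Q l - Q 0 = 0"
    using bc by (simp add: Q_def boundary_def)
  ultimately have "((\<lambda>x. complex_of_real ((2 * Re m) * (cmod (y x))^2)) has_integral of_real 0) {0..l}"
    by simp
  then have 0: "((\<lambda>x. (2 * Re m) * (cmod (y x))^2) has_integral 0) {0..l}"
    using has_integral_Re[of "\<lambda>x. complex_of_real ((2 * Re m) * (cmod (y x))^2)" 0 "{0..l}"] by simp
  show ?thesis
  proof (rule ccontr)
    assume m: "Re m \<noteq> 0"
    have "((\<lambda>x. (1 / (2 * Re m)) * ((2 * Re m) * (cmod (y x))^2)) has_integral (1 / (2 * Re m)) * 0) {0..l}"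
      by (rule has_integral_mult_right[OF 0])
    then have "integral {0..l} (\<lambda>x. (cmod (y x))^2) = 0"
      using m by (simp add: integral_unique)
    then have "\<forall>x\<in>{0..l}. (cmod (y x))^2 = 0"
      using l forced_system_continuous[OF sys]
      by (subst (asm) integral_eq_0_iff) (auto intro!: continuous_intros)
    then show False
      using nz by auto
  qed
qed

section \<open>Fundamental systems\<close>

text \<open>Isolates what the spectral argument uses of the solutions of y''' = m y with unit jets
  at 0. The abstraction treats m = 0, where the solutions are polynomials, together with the
  exponential case.\<close>

locale fundamental_system =
  fixes m :: complex and C S D :: "real \<Rightarrow> complex" and l :: real
  assumes l_pos: "0 < l"
    and C_deriv: "(C has_vector_derivative m * D x) (at x)"
    and S_deriv: "(S has_vector_derivative C x) (at x)"
    and D_deriv: "(D has_vector_derivative S x) (at x)"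
    and C_0: "C 0 = 1" and S_0: "S 0 = 0" and D_0: "D 0 = 0"
begin

section \<open>Duhamel's formula and variation of constants\<close>

lemma deriv_within:
  "(C has_vector_derivative m * D x) (at x within A)"
  "(S has_vector_derivative C x) (at x within A)"
  "(D has_vector_derivative S x) (at x within A)"
  using C_deriv S_deriv D_deriv has_vector_derivative_at_within by blast+

lemma deriv_reflected:
  "((\<lambda>s. C (x - s)) has_vector_derivative - (m * D (x - s))) (at s within A)"
  "((\<lambda>s. S (x - s)) has_vector_derivative - C (x - s)) (at s within A)"
  "((\<lambda>s. D (x - s)) has_vector_derivative - S (x - s)) (at s within A)"
proof -
  have r: "((\<lambda>s. x - s) has_vector_derivative -1) (at s within A)"
    by (rule has_vector_derivative_eq_rhs, (rule derivative_intros)+) simp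
  show "((\<lambda>s. C (x - s)) has_vector_derivative - (m * D (x - s))) (at s within A)"
    using vector_diff_chain_within[OF r deriv_within(1)] by (simp add: o_def)
  show "((\<lambda>s. S (x - s)) has_vector_derivative - C (x - s)) (at s within A)"
    using vector_diff_chain_within[OF r deriv_within(2)] by (simp add: o_def)
  show "((\<lambda>s. D (x - s)) has_vector_derivative - S (x - s)) (at s within A)"
    using vector_diff_chain_within[OF r deriv_within(3)] by (simp add: o_def)
qed

lemma deriv_shifted:
  "((\<lambda>s. C (s - h)) has_vector_derivative m * D (s - h)) (at s within A)"
  "((\<lambda>s. S (s - h)) has_vector_derivative C (s - h)) (at s within A)"
  "((\<lambda>s. D (s - h)) has_vector_derivative S (s - h)) (at s within A)"
proof -
  have r: "((\<lambda>s. s - h) has_vector_derivative 1) (at s within A)"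
    by (rule has_vector_derivative_eq_rhs, (rule derivative_intros)+) simp
  show "((\<lambda>s. C (s - h)) has_vector_derivative m * D (s - h)) (at s within A)"
    using vector_diff_chain_within[OF r deriv_within(1)] by (simp add: o_def)
  show "((\<lambda>s. S (s - h)) has_vector_derivative C (s - h)) (at s within A)"
    using vector_diff_chain_within[OF r deriv_within(2)] by (simp add: o_def)
  show "((\<lambda>s. D (s - h)) has_vector_derivative S (s - h)) (at s within A)"
    using vector_diff_chain_within[OF r deriv_within(3)] by (simp add: o_def)
qed

lemma continuous_on_system: "continuous_on A C" "continuous_on A S" "continuous_on A D"
  unfolding continuous_on_eq_continuous_within
  using deriv_within has_vector_derivative_continuous by blast+

text \<open>Yields uniqueness for given initial data and, later, the a priori bound, both without an
  explicit Green function.\<close>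

lemma duhamel:
  assumes sys: "forced_system m l G y y1 z" and x: "x \<in> {0..l}"
  shows "((\<lambda>s. S (x - s) * G s) has_integral y x - (C x * y 0 + S x * y1 0 + D x * z 0)) {0..x}"
    and "((\<lambda>s. C (x - s) * G s) has_integral
          y1 x - (m * D x * y 0 + C x * y1 0 + S x * z 0)) {0..x}"
proof -
  have d: "(y has_vector_derivative y1 s) (at s within {0..x})"
    "(y1 has_vector_derivative z s + G s) (at s within {0..x})"
    "(z has_vector_derivative m * y s) (at s within {0..x})" if "s \<in> {0..x}" for s
    using sys x that unfolding forced_system_def
    by (auto intro: has_vector_derivative_within_subset[where S="{0..l}"])
  \<comment> \<open>The value at \<open>x\<close> of the unforced solution that starts from the data
    of the system at \<open>s\<close>; it varies with \<open>s\<close> only through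
    \<open>G\<close>.\<close>
  define P where "P = (\<lambda>s. C (x - s) * y s + S (x - s) * y1 s + D (x - s) * z s)"
  have "((\<lambda>s. S (x - s) * G s) has_integral P x - P 0) {0..x}"
  proof (rule fundamental_theorem_of_calculus)
    fix s assume "s \<in> {0..x}"
    note d = d[OF this]
    have "(P has_vector_derivative
         (C (x - s) * y1 s + (- (m * D (x - s))) * y s)
       + (S (x - s) * (z s + G s) + (- C (x - s)) * y1 s)
       + (D (x - s) * (m * y s) + (- S (x - s)) * z s)) (at s within {0..x})"
      unfolding P_def
      by (intro has_vector_derivative_add has_vector_derivative_mult deriv_reflected d)
    then show "(P has_vector_derivative S (x - s) * G s) (at s within {0..x})"
      by (rule has_vector_derivative_eq_rhs) (simp add: algebra_simps)
  qed (use x in auto)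
  then show "((\<lambda>s. S (x - s) * G s) has_integral y x - (C x * y 0 + S x * y1 0 + D x * z 0)) {0..x}"
    by (simp add: P_def C_0 S_0 D_0)
  \<comment> \<open>The same quantity for the first derivative: each coefficient is replaced by its
    derivative in \<open>x\<close>.\<close>
  define R where "R = (\<lambda>s. m * D (x - s) * y s + C (x - s) * y1 s + S (x - s) * z s)"
  have "((\<lambda>s. C (x - s) * G s) has_integral R x - R 0) {0..x}"
  proof (rule fundamental_theorem_of_calculus)
    fix s assume "s \<in> {0..x}"
    note d = d[OF this]
    have "(R has_vector_derivative
         (m * D (x - s) * y1 s + (m * (- S (x - s))) * y s)
       + (C (x - s) * (z s + G s) + (- (m * D (x - s))) * y1 s)
       + (S (x - s) * (m * y s) + (- C (x - s)) * z s)) (at s within {0..x})"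
      unfolding R_def
      by (intro has_vector_derivative_add has_vector_derivative_mult has_vector_derivative_mult_right
          deriv_reflected d)
    then show "(R has_vector_derivative C (x - s) * G s) (at s within {0..x})"
      by (rule has_vector_derivative_eq_rhs) (simp add: algebra_simps)
  qed (use x in auto)
  then show "((\<lambda>s. C (x - s) * G s) has_integral
          y1 x - (m * D x * y 0 + C x * y1 0 + S x * z 0)) {0..x}"
    by (simp add: R_def C_0 S_0 D_0)
qed

lemma homogeneous:
  assumes sys: "forced_system m l (\<lambda>_. 0) y y1 z" and x: "x \<in> {0..l}"
  shows "y x = C x * y 0 + S x * y1 0 + D x * z 0"
    and "y1 x = m * D x * y 0 + C x * y1 0 + S x * z 0"
  using duhamel[OF assms] by auto

text \<open>The translates of \<open>S\<close> and \<open>D\<close> by \<open>x\<close> solve the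
  homogeneous system and have known jets at \<open>x\<close>, so \<open>homogeneous\<close>
  evaluated there gives the entries needed to see that the fundamental matrix at \<open>-x\<close>
  inverts the one at \<open>x\<close>.\<close>

lemma reflection_identities:
  assumes "x \<in> {0..l}"
  shows "C x * S (-x) + S x * C (-x) + D x * (m * D (-x)) = 0"
    and "m * D x * S (-x) + C x * C (-x) + S x * (m * D (-x)) = 1"
    and "C x * D (-x) + S x * S (-x) + D x * C (-x) = 0"
proof -
  have "forced_system m l (\<lambda>_. 0) (\<lambda>s. S (s - x)) (\<lambda>s. C (s - x)) (\<lambda>s. m * D (s - x))"
    unfolding forced_system_def
    by (auto intro!: deriv_shifted has_vector_derivative_mult_right)
  from homogeneous[OF this assms]
  show "C x * S (-x) + S x * C (-x) + D x * (m * D (-x)) = 0"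
    and "m * D x * S (-x) + C x * C (-x) + S x * (m * D (-x)) = 1"
    by (simp_all add: C_0 S_0 D_0)
  have "forced_system m l (\<lambda>_. 0) (\<lambda>s. D (s - x)) (\<lambda>s. S (s - x)) (\<lambda>s. C (s - x))"
    unfolding forced_system_def
    by (auto intro!: deriv_shifted)
  from homogeneous(1)[OF this assms]
  show "C x * D (-x) + S x * S (-x) + D x * C (-x) = 0"
    by (simp add: C_0 S_0 D_0)
qed

lemma homogeneous_system:
  "forced_system m l (\<lambda>_. 0) (\<lambda>x. b * S x + e * D x) (\<lambda>x. b * C x + e * S x)
     (\<lambda>x. b * (m * D x) + e * C x)"
  unfolding forced_system_def
proof (intro ballI conjI)
  fix x
  show "((\<lambda>x. b * S x + e * D x) has_vector_derivative b * C x + e * S x) (at x within {0..l})"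
    by (intro has_vector_derivative_add has_vector_derivative_mult_right deriv_within)
  have "((\<lambda>x. b * C x + e * S x) has_vector_derivative b * (m * D x) + e * C x) (at x within {0..l})"
    by (intro has_vector_derivative_add has_vector_derivative_mult_right deriv_within)
  then show "((\<lambda>x. b * C x + e * S x) has_vector_derivative b * (m * D x) + e * C x + 0) (at x within {0..l})"
    by simp
  have "((\<lambda>x. b * (m * D x) + e * C x) has_vector_derivative b * (m * S x) + e * (m * D x)) (at x within {0..l})"
    by (intro has_vector_derivative_add has_vector_derivative_mult_right deriv_within)
  then show "((\<lambda>x. b * (m * D x) + e * C x) has_vector_derivative m * (b * S x + e * D x)) (at x within {0..l})"
    by (rule has_vector_derivative_eq_rhs) (simp add: algebra_simps)
qed

text \<open>Variation of constants. Integrating functions of \<open>-s\<close> instead of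
  \<open>x - s\<close> keeps \<open>x\<close> out of the integrand, so each coefficient is a plain
  primitive.\<close>

lemma forced_system_particular:
  assumes G: "continuous_on {0..l} G"
  obtains v v1 w where "forced_system m l G v v1 w" "v 0 = 0" "v1 0 = 0" "w 0 = 0"
proof -
  have cr: "continuous_on A (\<lambda>s. C (- s))" "continuous_on A (\<lambda>s. S (- s))"
    "continuous_on A (\<lambda>s. D (- s))" for A
    by (rule continuous_on_compose2[OF continuous_on_system(1)[of UNIV]]
        continuous_on_compose2[OF continuous_on_system(2)[of UNIV]]
        continuous_on_compose2[OF continuous_on_system(3)[of UNIV]];
        auto intro!: continuous_intros)+
  \<comment> \<open>The integrands are the inverse fundamental matrix applied to the forcing, which
    enters only the second equation; hence its middle column \<open>S (-s)\<close>,
    \<open>C (-s)\<close>, \<open>m * D (-s)\<close>.\<close>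
  define a where "a = prim (\<lambda>s. S (-s) * G s)"
  define b where "b = prim (\<lambda>s. C (-s) * G s)"
  define e where "e = prim (\<lambda>s. m * D (-s) * G s)"
  have d: "(a has_vector_derivative S (-x) * G x) (at x within {0..l})"
    "(b has_vector_derivative C (-x) * G x) (at x within {0..l})"
    "(e has_vector_derivative m * D (-x) * G x) (at x within {0..l})" if "x \<in> {0..l}" for x
    unfolding a_def b_def e_def using that
    by (auto intro!: prim_has_vector_derivative continuous_intros cr G)
  define v where "v = (\<lambda>x. C x * a x + S x * b x + D x * e x)"
  define v1 where "v1 = (\<lambda>x. m * D x * a x + C x * b x + S x * e x)"
  define w where "w = (\<lambda>x. m * S x * a x + m * D x * b x + C x * e x)"
  have "forced_system m l G v v1 w"
    unfolding forced_system_def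
  proof (intro ballI conjI)
    fix x assume x: "x \<in> {0..l}"
    note d = d[OF x] and r = reflection_identities[OF x]
    have "(v has_vector_derivative
        (C x * (S (-x) * G x) + m * D x * a x) + (S x * (C (-x) * G x) + C x * b x)
        + (D x * (m * D (-x) * G x) + S x * e x)) (at x within {0..l})"
      unfolding v_def by (intro has_vector_derivative_add has_vector_derivative_mult deriv_within d)
    moreover have "(C x * (S (-x) * G x) + m * D x * a x) + (S x * (C (-x) * G x) + C x * b x)
        + (D x * (m * D (-x) * G x) + S x * e x)
        = v1 x + (C x * S (-x) + S x * C (-x) + D x * (m * D (-x))) * G x"
      by (simp add: v1_def algebra_simps)
    ultimately show "(v has_vector_derivative v1 x) (at x within {0..l})"
      unfolding r by simp
    have "(v1 has_vector_derivative
        (m * D x * (S (-x) * G x) + m * S x * a x) + (C x * (C (-x) * G x) + m * D x * b x)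
        + (S x * (m * D (-x) * G x) + C x * e x)) (at x within {0..l})"
      unfolding v1_def by (intro has_vector_derivative_add has_vector_derivative_mult
          has_vector_derivative_mult_right deriv_within d)
    moreover have "(m * D x * (S (-x) * G x) + m * S x * a x) + (C x * (C (-x) * G x) + m * D x * b x)
        + (S x * (m * D (-x) * G x) + C x * e x)
        = w x + (m * D x * S (-x) + C x * C (-x) + S x * (m * D (-x))) * G x"
      by (simp add: w_def algebra_simps)
    ultimately show "(v1 has_vector_derivative w x + G x) (at x within {0..l})"
      unfolding r by simp
    have "(w has_vector_derivative
        (m * S x * (S (-x) * G x) + m * C x * a x) + (m * D x * (C (-x) * G x) + m * S x * b x)
        + (C x * (m * D (-x) * G x) + m * D x * e x)) (at x within {0..l})"
      unfolding w_def by (intro has_vector_derivative_add has_vector_derivative_mult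
          has_vector_derivative_mult_right deriv_within d)
    moreover have "(m * S x * (S (-x) * G x) + m * C x * a x) + (m * D x * (C (-x) * G x) + m * S x * b x)
        + (C x * (m * D (-x) * G x) + m * D x * e x)
        = m * v x + m * (C x * D (-x) + S x * S (-x) + D x * C (-x)) * G x"
      by (simp add: v_def algebra_simps)
    ultimately show "(w has_vector_derivative m * v x) (at x within {0..l})"
      unfolding r by simp
  qed
  then show thesis
    by (rule that) (simp_all add: v_def v1_def w_def a_def b_def e_def)
qed

section \<open>The boundary value problem and its determinant\<close>

definition char_value :: complex where
  "char_value = (S l)^2 + D l * (1 - C l)"

lemma boundary_iff:
  "boundary l (\<lambda>x. b * S x + e * D x) (\<lambda>x. b * C x + e * S x)
     \<longleftrightarrow> b * (1 - C l) = e * S l \<and> b * S l + e * D l = 0"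
  by (auto simp: boundary_def C_0 S_0 D_0 algebra_simps)

lemma boundary_problem_solvable:
  assumes N: "char_value \<noteq> 0" and G: "continuous_on {0..l} G"
  obtains y y1 z where "forced_system m l G y y1 z" "boundary l y y1"
proof -
  obtain v v1 w where sys: "forced_system m l G v v1 w" and v0: "v 0 = 0" "v1 0 = 0" "w 0 = 0"
    using forced_system_particular[OF G] .
  \<comment> \<open>Cramer's rule for \<open>b * S l + e * D l = - v l\<close> and
    \<open>b * (C l - 1) + e * S l = - v1 l\<close>, the conditions at \<open>l\<close> after adding
    a homogeneous solution to \<open>v\<close>.\<close>
  define b where "b = (D l * v1 l - S l * v l) / char_value"
  define e where "e = ((C l - 1) * v l - S l * v1 l) / char_value"
  define y where "y = (\<lambda>x. v x + (b * S x + e * D x))"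
  define y1 where "y1 = (\<lambda>x. v1 x + (b * C x + e * S x))"
  define z where "z = (\<lambda>x. w x + (b * (m * D x) + e * C x))"
  have "forced_system m l G y y1 z"
    unfolding forced_system_def
  proof (intro ballI conjI)
    fix x assume x: "x \<in> {0..l}"
    have h: "((\<lambda>x. b * S x + e * D x) has_vector_derivative b * C x + e * S x) (at x within {0..l})"
      "((\<lambda>x. b * C x + e * S x) has_vector_derivative b * (m * D x) + e * C x) (at x within {0..l})"
      "((\<lambda>x. b * (m * D x) + e * C x) has_vector_derivative m * (b * S x + e * D x)) (at x within {0..l})"
      using homogeneous_system[of b e] x unfolding forced_system_def by auto
    have k: "(v has_vector_derivative v1 x) (at x within {0..l})"
      "(v1 has_vector_derivative w x + G x) (at x within {0..l})"
      "(w has_vector_derivative m * v x) (at x within {0..l})"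
      using sys x unfolding forced_system_def by auto
    show "(y has_vector_derivative y1 x) (at x within {0..l})"
      unfolding y_def y1_def by (intro has_vector_derivative_add h k)
    show "(y1 has_vector_derivative z x + G x) (at x within {0..l})"
      unfolding y1_def z_def
      by (rule has_vector_derivative_eq_rhs[OF has_vector_derivative_add[OF k(2) h(2)]]) simp
    show "(z has_vector_derivative m * y x) (at x within {0..l})"
      unfolding y_def z_def
      by (rule has_vector_derivative_eq_rhs[OF has_vector_derivative_add[OF k(3) h(3)]])
        (simp add: algebra_simps)
  qed
  moreover have "boundary l y y1"
    unfolding boundary_def
  proof (intro conjI)
    show "y 0 = 0"
      by (simp add: y_def v0 S_0 D_0)
    have "char_value * (v l + (b * S l + e * D l)) =
        char_value * v l + (char_value * b) * S l + (char_value * e) * D l"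
      by (simp add: algebra_simps)
    also have "\<dots> = char_value * v l + (D l * v1 l - S l * v l) * S l
        + ((C l - 1) * v l - S l * v1 l) * D l"
      using N by (simp add: b_def e_def)
    also have "\<dots> = 0"
      by (simp add: char_value_def algebra_simps power2_eq_square)
    finally show "y l = 0"
      using N by (simp add: y_def)
    have "char_value * (v1 l + (b * (C l - 1) + e * S l)) =
        char_value * v1 l + (char_value * b) * (C l - 1) + (char_value * e) * S l"
      by (simp add: algebra_simps)
    also have "\<dots> = char_value * v1 l + (D l * v1 l - S l * v l) * (C l - 1)
        + ((C l - 1) * v l - S l * v1 l) * S l"
      using N by (simp add: b_def e_def)
    also have "\<dots> = 0"
      by (simp add: char_value_def algebra_simps power2_eq_square)
    finally have "v1 l + (b * (C l - 1) + e * S l) = 0"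
      using N by simp
    then show "y1 0 = y1 l"
      by (simp add: y1_def v0 S_0 C_0 algebra_simps)
  qed
  ultimately show thesis
    by (rule that)
qed

lemma system_bounded:
  obtains K where "1 \<le> K" "\<And>x. x \<in> {0..l} \<Longrightarrow> cmod (C x) \<le> K"
    "\<And>x. x \<in> {0..l} \<Longrightarrow> cmod (S x) \<le> K" "\<And>x. x \<in> {0..l} \<Longrightarrow> cmod (D x) \<le> K"
proof -
  have "\<exists>B. \<forall>x\<in>{0..l}. cmod (u x) \<le> B" if "continuous_on {0..l} u" for u
  proof -
    have "bounded (u ` {0..l})"
      by (intro compact_imp_bounded compact_continuous_image that) auto
    then show ?thesis
      unfolding bounded_iff by auto
  qed
  then obtain B1 B2 B3 where "\<forall>x\<in>{0..l}. cmod (C x) \<le> B1" "\<forall>x\<in>{0..l}. cmod (S x) \<le> B2"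
    "\<forall>x\<in>{0..l}. cmod (D x) \<le> B3"
    using continuous_on_system by metis
  then show thesis
    by (intro that[of "max 1 (max B1 (max B2 B3))"]) (auto simp: le_max_iff_disj)
qed

text \<open>Duhamel's formula at \<open>l\<close> is a linear system for the unknown initial data
  with determinant \<open>char_value\<close>; Cramer's rule bounds the data, and Duhamel's formula
  at \<open>x\<close> then bounds the solution. The bound holds for every solution, so it also
  contains injectivity.\<close>

lemma boundary_problem_bounded:
  assumes N: "char_value \<noteq> 0"
  obtains K where "0 \<le> K" "\<And>G y y1 z M x. \<lbrakk>forced_system m l G y y1 z; boundary l y y1;
      \<And>s. s \<in> {0..l} \<Longrightarrow> cmod (G s) \<le> M; x \<in> {0..l}\<rbrakk> \<Longrightarrow> cmod (y x) \<le> K * M"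
proof -
  obtain K where K1: "1 \<le> K" and K: "\<And>x. x \<in> {0..l} \<Longrightarrow> cmod (C x) \<le> K"
    "\<And>x. x \<in> {0..l} \<Longrightarrow> cmod (S x) \<le> K" "\<And>x. x \<in> {0..l} \<Longrightarrow> cmod (D x) \<le> K"
    using system_bounded by metis
  define n where "n = cmod char_value"
  have n: "0 < n"
    using N by (simp add: n_def)
  \<comment> \<open>The summands bound \<open>S x * b\<close>, \<open>D x * e\<close> and the
    Duhamel integral; 2 and 3 count the products of size at most \<open>K * T\<close> in the Cramer
    numerators.\<close>
  define K' where "K' = K * (2 * K * (K * l) / n) + K * (3 * K * (K * l) / n) + K * l"
  have "0 \<le> K'"
    using K1 l_pos n by (simp add: K'_def)
  moreover have "cmod (y x) \<le> K' * M"
    if sys: "forced_system m l G y y1 z" and bc: "boundary l y y1"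
      and M: "\<And>s. s \<in> {0..l} \<Longrightarrow> cmod (G s) \<le> M" and x: "x \<in> {0..l}" for G y y1 z M x
  proof -
    have l0: "l \<in> {0..l}"
      using l_pos by simp
    have M0: "0 \<le> M"
      using order_trans[OF norm_ge_zero M[OF l0]] .
    define T where "T = K * l * M"
    have T0: "0 \<le> T"
      using K1 M0 l_pos by (simp add: T_def)
    have bound: "cmod i \<le> T"
      if "((\<lambda>s. u (x - s) * G s) has_integral i) {0..x}" "x \<in> {0..l}"
        "\<And>x. x \<in> {0..l} \<Longrightarrow> cmod (u x) \<le> K" for u i x
    proof -
      have "cmod i \<le> (K * M) * measure lborel (cbox 0 x)"
      proof (rule has_integral_bound)
        show "0 \<le> K * M"
          using K1 M0 by simp
        show "((\<lambda>s. u (x - s) * G s) has_integral i) (cbox 0 x)"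
          using that(1) by simp
        fix s assume "s \<in> cbox 0 x"
        then show "cmod (u (x - s) * G s) \<le> K * M"
          unfolding norm_mult using that(2) K1 by (intro mult_mono that(3) M) auto
      qed
      also have "\<dots> = (K * M) * x"
        using that(2) by simp
      also have "\<dots> \<le> (K * M) * l"
        using that(2) K1 M0 by (intro mult_left_mono) auto
      finally show ?thesis
        by (simp add: T_def mult_ac)
    qed
    have y0: "y 0 = 0" "y1 l = y1 0" "y l = 0"
      using bc by (auto simp: boundary_def)
    define b where "b = y1 0"
    define e where "e = z 0"
    \<comment> \<open>By the boundary conditions, \<open>r\<close> and \<open>r1\<close> are the two
      Duhamel integrals at \<open>l\<close>.\<close>
    define r where "r = 0 - (S l * b + D l * e)"
    define r1 where "r1 = b - (C l * b + S l * e)"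
    have rT: "cmod r \<le> T"
      using bound[of S l r] duhamel(1)[OF sys l0] K l0 by (simp add: r_def b_def e_def y0)
    have r1T: "cmod r1 \<le> T"
      using bound[of C l r1] duhamel(2)[OF sys l0] K l0 by (simp add: r1_def b_def e_def y0)
    have "char_value * b = - (S l * r) + D l * r1"
      by (simp add: char_value_def r_def r1_def algebra_simps power2_eq_square)
    then have "n * cmod b = cmod (- (S l * r) + D l * r1)"
      by (metis n_def norm_mult)
    also have "\<dots> \<le> cmod (S l) * cmod r + cmod (D l) * cmod r1"
      by (metis norm_minus_cancel norm_mult norm_triangle_ineq)
    also have "\<dots> \<le> K * T + K * T"
      using K K1 l0 rT r1T by (intro add_mono mult_mono) auto
    finally have bT: "cmod b \<le> 2 * K * T / n"
      using n by (simp add: field_simps)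
    have "char_value * e = - (S l * r1) + (C l * r - r)"
      by (simp add: char_value_def r_def r1_def algebra_simps power2_eq_square)
    then have "n * cmod e = cmod (- (S l * r1) + (C l * r - r))"
      by (metis n_def norm_mult)
    also have "\<dots> \<le> cmod (- (S l * r1)) + (cmod (C l * r) + cmod r)"
      by (intro order_trans[OF norm_triangle_ineq] add_mono order_refl norm_triangle_ineq4)
    also have "\<dots> \<le> K * T + (K * T + K * T)"
      unfolding norm_minus_cancel norm_mult
    proof (intro add_mono mult_mono)
      show "cmod r \<le> K * T"
        using rT mult_right_mono[OF K1 T0] by simp
    qed (use K K1 l0 rT r1T in auto)
    finally have eT: "cmod e \<le> 3 * K * T / n"
      using n by (simp add: field_simps)
    have "cmod (y x - (S x * b + D x * e)) \<le> T"
      using bound[of S x] duhamel(1)[OF sys x] K x by (simp add: b_def e_def y0)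
    then have "cmod (y x) \<le> cmod (S x * b + D x * e) + T"
      using norm_triangle_sub[of "y x" "S x * b + D x * e"] by linarith
    also have "cmod (S x * b + D x * e) \<le> cmod (S x) * cmod b + cmod (D x) * cmod e"
      by (metis norm_mult norm_triangle_ineq)
    also have "\<dots> \<le> K * (2 * K * T / n) + K * (3 * K * T / n)"
      using K K1 x bT eT by (intro add_mono mult_mono) auto
    finally have "cmod (y x) \<le> K * (2 * K * T / n) + K * (3 * K * T / n) + T"
      by simp
    also have "\<dots> = K' * M"
      by (simp add: K'_def T_def algebra_simps)
    finally show ?thesis .
  qed
  ultimately show thesis
    by (rule that)
qed

lemma homogeneous_boundary_solution:
  assumes "char_value = 0"
  obtains b e where "boundary l (\<lambda>x. b * S x + e * D x) (\<lambda>x. b * C x + e * S x)"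
    "\<exists>x\<in>{0..l}. b * S x + e * D x \<noteq> 0"
proof -
  have "\<exists>b e. (b \<noteq> 0 \<or> e \<noteq> 0) \<and> b * (1 - C l) = e * S l \<and> b * S l + e * D l = 0"
  \<comment> \<open>A singular system has the kernel vector \<open>(S l, 1 - C l)\<close>. If that
    is zero, the first equation is trivial and the second reads \<open>e * D l = 0\<close>, so
    \<open>(1, 0)\<close> serves.\<close>
  proof (cases "S l = 0 \<and> C l = 1")
    case True
    then show ?thesis
      by (cases "D l = 0") (auto intro: exI[of _ 1] exI[of _ 0])
  next
    case False
    have "S l * S l + (1 - C l) * D l = 0"
      using assms by (simp add: char_value_def power2_eq_square mult.commute)
    then show ?thesis
      using False by (intro exI[of _ "S l"] exI[of _ "1 - C l"]) (auto simp: algebra_simps)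
  qed
  then obtain b e where be: "b \<noteq> 0 \<or> e \<noteq> 0" "b * (1 - C l) = e * S l" "b * S l + e * D l = 0"
    by blast
  have "\<exists>x\<in>{0..l}. b * S x + e * D x \<noteq> 0"
  proof (rule ccontr)
    assume "\<not> ?thesis"
    then have "\<forall>x\<in>{0..l}. b * S x + e * D x = 0"
      by blast
    from forced_system_zero[OF homogeneous_system l_pos this, of 0] l_pos
    have "b = 0 \<and> e = 0"
      by (simp add: C_0 S_0 D_0)
    then show False
      using be by blast
  qed
  with be show thesis
    by (intro that[of b e]) (auto simp: boundary_iff)
qed

text \<open>If the determinant vanishes, a nonzero kernel element violates the norm estimate;
  otherwise solvability gives surjectivity, and the sup bound gives the estimate.\<close>

lemma resolvent_iff:
  assumes m: "m = -\<i> * \<mu>"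
  shows "\<mu> \<in> resolvent_L0 l \<longleftrightarrow> char_value \<noteq> 0"
proof
  assume res: "\<mu> \<in> resolvent_L0 l"
  show "char_value \<noteq> 0"
  proof
    assume "char_value = 0"
    then obtain b e where be: "boundary l (\<lambda>x. b * S x + e * D x) (\<lambda>x. b * C x + e * S x)"
      "\<exists>x\<in>{0..l}. b * S x + e * D x \<noteq> 0"
      by (rule homogeneous_boundary_solution)
    define y where "y = (\<lambda>x. b * S x + e * D x)"
    have "L2 l (\<lambda>_. 0)"
      by (intro L2_continuous continuous_intros)
    moreover have "prim (\<lambda>_. 0) x = 0" for x
      by (simp add: prim_def)
    ultimately have "is_L0 l y (\<lambda>x. 0 + \<mu> * y x)"
      using homogeneous_system[of b e] be(1) unfolding y_def m
      by (intro forced_system_imp_is_L0) auto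
    moreover obtain K where "\<forall>y h. is_L0 l y h \<longrightarrow> L2norm l y \<le> K * L2norm l (\<lambda>x. h x - \<mu> * y x)"
      using res unfolding resolvent_L0_def by blast
    ultimately have "L2norm l y \<le> K * L2norm l (\<lambda>x. (0 + \<mu> * y x) - \<mu> * y x)"
      by blast
    also have "\<dots> = 0"
      by (simp add: L2norm_def)
    finally have "L2norm l y = 0"
      using L2norm_nonneg[of l y] by linarith
    then have "\<forall>x\<in>{0..l}. y x = 0"
      by (subst (asm) L2norm_eq_0_iff_continuous[OF l_pos])
        (auto simp: y_def intro!: continuous_intros continuous_on_system)
    then show False
      using be(2) by (simp add: y_def)
  qed
next
  assume N: "char_value \<noteq> 0"
  have "\<exists>y. is_L0 l y (\<lambda>x. f x + \<mu> * y x)" if f: "L2 l f" for f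
  proof -
    have "continuous_on {0..l} (\<lambda>x. - \<i> * prim f x)"
      by (intro continuous_intros continuous_on_prim f)
    then obtain y y1 z where "forced_system m l (\<lambda>x. - \<i> * prim f x) y y1 z" "boundary l y y1"
      by (rule boundary_problem_solvable[OF N])
    then show ?thesis
      using forced_system_imp_is_L0[OF f] unfolding m by blast
  qed
  moreover obtain K where K: "0 \<le> K" "\<And>G y y1 z M x. \<lbrakk>forced_system m l G y y1 z; boundary l y y1;
      \<And>s. s \<in> {0..l} \<Longrightarrow> cmod (G s) \<le> M; x \<in> {0..l}\<rbrakk> \<Longrightarrow> cmod (y x) \<le> K * M"
    using boundary_problem_bounded[OF N] by metis
  \<comment> \<open>One factor \<open>sqrt l\<close> comes from bounding the \<open>L2norm\<close>
    of \<open>y\<close> by its supremum, the other from bounding the primitive of \<open>f\<close>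
    by \<open>L2norm l f\<close>.\<close>
  have "L2norm l y \<le> (sqrt l * (K * sqrt l)) * L2norm l (\<lambda>x. h x - \<mu> * y x)"
    if y: "is_L0 l y h" for y h
  proof -
    define f where "f = (\<lambda>x. h x - \<mu> * y x)"
    have f: "L2 l f"
      using is_L0_imp_forced_system(1)[OF y] by (simp add: f_def)
    obtain y1 z where sys: "forced_system m l (\<lambda>x. - \<i> * prim f x) y y1 z" and bc: "boundary l y y1"
      using is_L0_imp_forced_system(2)[OF y, of \<mu>] unfolding m f_def by blast
    have "cmod (y x) \<le> K * (sqrt l * L2norm l f)" if "x \<in> {0..l}" for x
      by (rule K(2)[OF sys bc _ that]) (simp add: norm_mult norm_prim_le[OF l_pos f])
    then have "L2norm l y \<le> sqrt l * (K * (sqrt l * L2norm l f))"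
      by (rule L2norm_le_sup[OF l_pos forced_system_continuous(1)[OF sys]])
    then show ?thesis
      by (simp add: f_def mult.assoc)
  qed
  ultimately show "\<mu> \<in> resolvent_L0 l"
    unfolding resolvent_L0_def by blast
qed

lemma char_value_0_imp_real:
  assumes "m = -\<i> * \<mu>" "char_value = 0"
  shows "\<mu> \<in> \<real>"
proof -
  obtain b e where "boundary l (\<lambda>x. b * S x + e * D x) (\<lambda>x. b * C x + e * S x)"
      "\<exists>x\<in>{0..l}. b * S x + e * D x \<noteq> 0"
    using assms(2) by (rule homogeneous_boundary_solution)
  then have "Re m = 0"
    using boundary_imp_Re_eq_0[OF homogeneous_system _ l_pos] by blast
  then show ?thesis
    using assms(1) by (simp add: complex_is_Real_iff)
qed

text \<open>The condition \<open>y1 0 = y1 l\<close> is one linear equation for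
  \<open>(y1 0, z 0)\<close>. By \<open>nz\<close> it is nontrivial, so its solutions form the line
  spanned by \<open>(S l, 1 - C l)\<close>.\<close>

lemma eigenfunction_unique:
  assumes m: "m = -\<i> * \<mu>" and y: "is_L0 l y (\<lambda>x. \<mu> * y x)" and nz: "S l \<noteq> 0 \<or> C l \<noteq> 1"
  shows "\<exists>c. \<forall>x\<in>{0..l}. y x = c * (S l * S x + (1 - C l) * D x)"
proof -
  have "prim (\<lambda>x. \<mu> * y x - \<mu> * y x) x = 0" for x
    by (simp add: prim_def)
  then obtain y1 z where sys: "forced_system m l (\<lambda>_. 0) y y1 z" and bc: "boundary l y y1"
    using is_L0_imp_forced_system(2)[OF y, of \<mu>] unfolding m by auto
  have l0: "l \<in> {0..l}"
    using l_pos by simp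
  have eq: "y x = S x * y1 0 + D x * z 0" if "x \<in> {0..l}" for x
    using homogeneous(1)[OF sys that] bc by (simp add: boundary_def)
  have "y1 l = C l * y1 0 + S l * z 0"
    using homogeneous(2)[OF sys l0] bc by (simp add: boundary_def)
  then have k: "y1 0 * (1 - C l) = z 0 * S l"
    using bc by (simp add: boundary_def algebra_simps)
  show ?thesis
  proof (cases "S l = 0")
    case False
    have "y x = (y1 0 / S l) * (S l * S x + (1 - C l) * D x)" if "x \<in> {0..l}" for x
    proof -
      have "(y1 0 / S l) * (S l * S x + (1 - C l) * D x)
          = y1 0 * S x + (y1 0 * (1 - C l)) / S l * D x"
        using False by (simp add: field_simps)
      then show ?thesis
        using False eq[OF that] by (simp add: k)
    qed
    then show ?thesis
      by blast
  next
    case True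
    then have C: "1 - C l \<noteq> 0" and "y1 0 = 0"
      using nz k by auto
    then have "y x = (z 0 / (1 - C l)) * (S l * S x + (1 - C l) * D x)" if "x \<in> {0..l}" for x
      using eq[OF that] True by simp
    then show ?thesis
      by blast
  qed
qed

text \<open>The scale \<open>a\<close> allows for the factor by which \<open>eigfun\<close> differs
  from the combination of the normalised \<open>S\<close> and \<open>D\<close>.\<close>

lemma eigenfunction:
  assumes m: "m = -\<i> * \<mu>" and N: "char_value = 0" and nz: "S l \<noteq> 0 \<or> C l \<noteq> 1" and a: "a \<noteq> 0"
  defines "y \<equiv> \<lambda>x. a * (S l * S x + (1 - C l) * D x)"
  shows "is_L0 l y (\<lambda>x. \<mu> * y x)" and "continuous_on {0..l} y" and "\<exists>x\<in>{0..l}. y x \<noteq> 0"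
proof -
  have y: "y = (\<lambda>x. a * S l * S x + a * (1 - C l) * D x)"
    by (auto simp: y_def algebra_simps)
  show "continuous_on {0..l} y"
    unfolding y by (intro continuous_intros continuous_on_system)
  \<comment> \<open>These coefficients meet the derivative condition identically; vanishing at
    \<open>l\<close> comes from \<open>char_value = 0\<close>.\<close>
  have "S l * S l + (1 - C l) * D l = 0"
    using N by (simp add: char_value_def power2_eq_square mult.commute)
  then have "y l = 0"
    by (simp add: y_def)
  then have "boundary l y (\<lambda>x. a * S l * C x + a * (1 - C l) * S x)"
    unfolding y boundary_iff by simp
  moreover have "L2 l (\<lambda>_. 0)" "\<And>x. prim (\<lambda>_. 0) x = 0"
    by (auto simp: prim_def intro!: L2_continuous continuous_intros)
  ultimately have "is_L0 l y (\<lambda>x. 0 + \<mu> * y x)"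
    using homogeneous_system[of "a * S l" "a * (1 - C l)"] unfolding m y[symmetric]
    by (intro forced_system_imp_is_L0) auto
  then show "is_L0 l y (\<lambda>x. \<mu> * y x)"
    by simp
  show "\<exists>x\<in>{0..l}. y x \<noteq> 0"
  proof (rule ccontr)
    assume "\<not> ?thesis"
    then have "\<forall>x\<in>{0..l}. a * S l * S x + a * (1 - C l) * D x = 0"
      unfolding y by blast
    from forced_system_zero[OF homogeneous_system l_pos this, of 0] l_pos
    show False
      using nz a by (simp add: C_0 S_0 D_0)
  qed
qed

end

section \<open>The exponential fundamental system\<close>

lemma zeta_relations:
  "zeta 1 = 1" "zeta 2 ^ 2 = zeta 3" "zeta 3 ^ 2 = zeta 2" "zeta 2 * zeta 3 = 1"
  "1 + zeta 2 + zeta 3 = 0"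
  by (auto simp: zeta_def complex_eq_iff power2_eq_square)

lemma exp_sums:
  shows cfun_eq: "cfun z = (exp z + exp (z * zeta 2) + exp (z * zeta 3)) / 3"
    and sfun_eq: "sfun z = (exp z + zeta 3 * exp (z * zeta 2) + zeta 2 * exp (z * zeta 3)) / 3"
    and dfun_eq: "dfun z = (exp z + zeta 2 * exp (z * zeta 2) + zeta 3 * exp (z * zeta 3)) / 3"
proof -
  have inv: "inverse (zeta 2) = zeta 3" "inverse (zeta 3) = zeta 2"
    using zeta_relations(4) inverse_unique mult.commute by metis+
  show "cfun z = (exp z + exp (z * zeta 2) + exp (z * zeta 3)) / 3"
    "sfun z = (exp z + zeta 3 * exp (z * zeta 2) + zeta 2 * exp (z * zeta 3)) / 3"
    "dfun z = (exp z + zeta 2 * exp (z * zeta 2) + zeta 3 * exp (z * zeta 3)) / 3"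
    by (simp_all add: cfun_def sfun_def dfun_def zeta_relations(1-3) inv)
      (simp_all add: zeta_def)
qed

lemma zeta_3_eq: "zeta 3 = - 1 - zeta 2"
  using zeta_relations(5) by (simp add: algebra_simps add_eq_0_iff)

text \<open>With \<open>zeta_3_eq\<close>, reduces polynomials in the roots of unity to expressions
  linear in \<open>zeta 2\<close>; the second equation catches products nested to the right.\<close>

lemma zeta_2_square: "zeta 2 * zeta 2 = - 1 - zeta 2" "zeta 2 * (zeta 2 * u) = - u - zeta 2 * u"
proof -
  show W: "zeta 2 * zeta 2 = - 1 - zeta 2"
    using zeta_relations(2) zeta_3_eq by (simp add: power2_eq_square)
  show "zeta 2 * (zeta 2 * u) = - u - zeta 2 * u"
    by (simp add: W left_diff_distrib flip: mult.assoc)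
qed

text \<open>Inversion of the discrete Fourier transform of order 3 that defines \<open>cfun\<close>,
  \<open>sfun\<close> and \<open>dfun\<close>.\<close>

lemma exp_zeta_eq:
  shows "exp z = cfun z + sfun z + dfun z"
    and "exp (z * zeta 2) = cfun z + zeta 2 * sfun z + zeta 3 * dfun z"
    and "exp (z * zeta 3) = cfun z + zeta 3 * sfun z + zeta 2 * dfun z"
proof -
  define a where "a = exp z"
  define b where "b = exp (z * zeta 2)"
  define g where "g = exp (z * zeta 3)"
  note abg = a_def[symmetric] b_def[symmetric] g_def[symmetric]
  have triple: "a + b + g = 3 * cfun z" "a + zeta 3 * b + zeta 2 * g = 3 * sfun z"
    "a + zeta 2 * b + zeta 3 * g = 3 * dfun z"
    unfolding exp_sums abg by simp_all
  have cancel: "x = y" if "3 * x = 3 * y" for x y :: complex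
    using that by simp
  have "3 * a = (a + b + g) + (a + zeta 3 * b + zeta 2 * g) + (a + zeta 2 * b + zeta 3 * g)"
    unfolding zeta_3_eq by (simp add: algebra_simps)
  then have "3 * a = 3 * (cfun z + sfun z + dfun z)"
    unfolding triple by (simp add: algebra_simps)
  then show "exp z = cfun z + sfun z + dfun z"
    unfolding abg by (rule cancel)
  have "3 * b = (a + b + g) + zeta 2 * (a + zeta 3 * b + zeta 2 * g)
      + zeta 3 * (a + zeta 2 * b + zeta 3 * g)"
    unfolding zeta_3_eq by (simp add: algebra_simps zeta_2_square)
  then have "3 * b = 3 * (cfun z + zeta 2 * sfun z + zeta 3 * dfun z)"
    unfolding triple by (simp add: algebra_simps)
  then show "exp (z * zeta 2) = cfun z + zeta 2 * sfun z + zeta 3 * dfun z"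
    unfolding abg by (rule cancel)
  have "3 * g = (a + b + g) + zeta 3 * (a + zeta 3 * b + zeta 2 * g)
      + zeta 2 * (a + zeta 2 * b + zeta 3 * g)"
    unfolding zeta_3_eq by (simp add: algebra_simps zeta_2_square)
  then have "3 * g = 3 * (cfun z + zeta 3 * sfun z + zeta 2 * dfun z)"
    unfolding triple by (simp add: algebra_simps)
  then show "exp (z * zeta 3) = cfun z + zeta 3 * sfun z + zeta 2 * dfun z"
    unfolding abg by (rule cancel)
qed

lemma prod_exp_zeta: "exp z * exp (z * zeta 2) * exp (z * zeta 3) = 1"
proof -
  have "exp z * exp (z * zeta 2) * exp (z * zeta 3) = exp (z * (1 + zeta 2 + zeta 3))"
    by (simp add: exp_add algebra_simps)
  then show ?thesis
    by (simp add: zeta_relations)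
qed

text \<open>The three exponentials have product 1, so each inverse is the product of the other two
  and \<open>dfun (- z)\<close> becomes quadratic in them. What remains is a polynomial identity
  modulo the relation for \<open>zeta 2\<close>.\<close>

lemma char_identity: "sfun z ^ 2 + dfun z * (1 - cfun z) = dfun z + dfun (- z)"
proof -
  define a where "a = exp z"
  define b where "b = exp (z * zeta 2)"
  define g where "g = exp (z * zeta 3)"
  note abg = a_def[symmetric] b_def[symmetric] g_def[symmetric]
  have p: "a * b * g = 1"
    using prod_exp_zeta[of z] unfolding abg .
  have inv: "inverse a = b * g" "inverse b = a * g" "inverse g = a * b"
    by (rule inverse_unique, use p in \<open>simp add: mult_ac\<close>)+
  have d: "dfun (- z) = (b * g + zeta 2 * (a * g) + zeta 3 * (a * b)) / 3"
    unfolding dfun_eq mult_minus_left exp_minus abg inv ..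
  have "(a + zeta 3 * b + zeta 2 * g)^2 - (a + zeta 2 * b + zeta 3 * g) * (a + b + g)
      = 3 * (b * g + zeta 2 * (a * g) + zeta 3 * (a * b))"
    unfolding zeta_3_eq by (simp add: power2_eq_square algebra_simps zeta_2_square)
  then have "sfun z ^ 2 - dfun z * cfun z = dfun (- z)"
    unfolding d unfolding exp_sums abg by (simp add: power_divide diff_divide_distrib[symmetric])
  then show ?thesis
    by (simp add: algebra_simps)
qed

lemma exp_sum_derivs:
  shows "(cfun has_field_derivative dfun z) (at z)"
    and "(sfun has_field_derivative cfun z) (at z)"
    and "(dfun has_field_derivative sfun z) (at z)"
proof -
  have *: "zeta 3 * (exp w * zeta 2) = exp w" "zeta 2 * (exp w * zeta 3) = exp w"
    "zeta 2 * (exp w * zeta 2) = zeta 3 * exp w" "zeta 3 * (exp w * zeta 3) = zeta 2 * exp w" for w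
    using zeta_relations(2-4) by (simp_all add: power2_eq_square flip: mult.assoc)
      (simp_all add: mult_ac)
  have "((\<lambda>z. (exp z + exp (z * zeta 2) + exp (z * zeta 3)) / 3) has_field_derivative
      (exp z + exp (z * zeta 2) * zeta 2 + exp (z * zeta 3) * zeta 3) / 3) (at z)"
    by (auto intro!: derivative_eq_intros)
  then show "(cfun has_field_derivative dfun z) (at z)"
    by (simp add: exp_sums[abs_def] mult_ac)
  have "((\<lambda>z. (exp z + zeta 3 * exp (z * zeta 2) + zeta 2 * exp (z * zeta 3)) / 3) has_field_derivative
      (exp z + zeta 3 * (exp (z * zeta 2) * zeta 2) + zeta 2 * (exp (z * zeta 3) * zeta 3)) / 3) (at z)"
    by (auto intro!: derivative_eq_intros)
  then show "(sfun has_field_derivative cfun z) (at z)"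
    unfolding * by (simp add: exp_sums[abs_def])
  have "((\<lambda>z. (exp z + zeta 2 * exp (z * zeta 2) + zeta 3 * exp (z * zeta 3)) / 3) has_field_derivative
      (exp z + zeta 2 * (exp (z * zeta 2) * zeta 2) + zeta 3 * (exp (z * zeta 3) * zeta 3)) / 3) (at z)"
    by (auto intro!: derivative_eq_intros)
  then show "(dfun has_field_derivative sfun z) (at z)"
    unfolding * by (simp add: exp_sums[abs_def])
qed

lemma exp_sums_0: "cfun 0 = 1" "sfun 0 = 0" "dfun 0 = 0"
  using zeta_relations(5) by (simp_all add: exp_sums add_ac)

text \<open>Division by \<kappa> and its square offsets the chain rule and normalises the jets at
  0.\<close>

lemma fundamental_system_exp:
  assumes "\<kappa> \<noteq> 0" "0 < l"
  shows "fundamental_system (\<kappa> ^ 3) (\<lambda>x. cfun (\<kappa> * of_real x))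
    (\<lambda>x. sfun (\<kappa> * of_real x) / \<kappa>) (\<lambda>x. dfun (\<kappa> * of_real x) / \<kappa> ^ 2) l"
proof
  fix x :: real
  have lin: "((\<lambda>x. \<kappa> * of_real x) has_vector_derivative \<kappa>) (at x)"
    using has_vector_derivative_mult_right[OF has_vector_derivative_of_real, of "\<lambda>x. x" 1 "at x" \<kappa>]
    by (simp add: has_vector_derivative_id[unfolded id_def])
  have d: "((\<lambda>x. cfun (\<kappa> * of_real x)) has_vector_derivative \<kappa> * dfun (\<kappa> * of_real x)) (at x)"
    "((\<lambda>x. sfun (\<kappa> * of_real x)) has_vector_derivative \<kappa> * cfun (\<kappa> * of_real x)) (at x)"
    "((\<lambda>x. dfun (\<kappa> * of_real x)) has_vector_derivative \<kappa> * sfun (\<kappa> * of_real x)) (at x)"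
    using field_vector_diff_chain_at[OF lin exp_sum_derivs(1)]
      field_vector_diff_chain_at[OF lin exp_sum_derivs(2)]
      field_vector_diff_chain_at[OF lin exp_sum_derivs(3)]
    by (simp_all add: o_def)
  show "((\<lambda>x. cfun (\<kappa> * of_real x)) has_vector_derivative
      \<kappa> ^ 3 * (dfun (\<kappa> * of_real x) / \<kappa> ^ 2)) (at x)"
    by (rule has_vector_derivative_eq_rhs[OF d(1)])
      (use assms in \<open>simp add: field_simps power2_eq_square power3_eq_cube\<close>)
  show "((\<lambda>x. sfun (\<kappa> * of_real x) / \<kappa>) has_vector_derivative cfun (\<kappa> * of_real x)) (at x)"
    by (rule has_vector_derivative_eq_rhs[OF has_vector_derivative_divide[OF d(2)]])
      (use assms in simp)
  show "((\<lambda>x. dfun (\<kappa> * of_real x) / \<kappa> ^ 2) has_vector_derivative sfun (\<kappa> * of_real x) / \<kappa>) (at x)"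
    by (rule has_vector_derivative_eq_rhs[OF has_vector_derivative_divide[OF d(3)]])
      (use assms in \<open>simp add: field_simps power2_eq_square\<close>)
qed (use assms exp_sums_0 in auto)

lemma fundamental_system_0:
  assumes "0 < l"
  shows "fundamental_system 0 (\<lambda>_. 1) of_real (\<lambda>x. (of_real x)^2 / 2) l"
proof
  fix x :: real
  show d: "(complex_of_real has_vector_derivative 1) (at x)"
    by (rule has_vector_derivative_eq_rhs, rule has_vector_derivative_of_real, rule derivative_intros) simp
  have "((\<lambda>x. of_real x * of_real x / 2) has_vector_derivative
      (of_real x * 1 + 1 * of_real x) / (2::complex)) (at x)"
    by (intro has_vector_derivative_divide has_vector_derivative_mult d)
  then show "((\<lambda>x. (of_real x)^2 / 2) has_vector_derivative complex_of_real x) (at x)"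
    by (simp add: power2_eq_square)
qed (use assms in auto)

section \<open>Zeros of the characteristic function\<close>

lemma cnj_dfun: "cnj (dfun z) = dfun (cnj z)"
proof -
  have "cnj (zeta 2) = zeta 3" "cnj (zeta 3) = zeta 2"
    by (simp_all add: zeta_def complex_eq_iff)
  then show ?thesis
    by (simp add: dfun_eq exp_cnj add_ac)
qed

text \<open>Conjugation sends \<i>\<tau> to its negative, so the two summands are conjugate. The
  zeros for real parameter thus become those of a real function, open to sign arguments.\<close>

lemma char_function_imaginary:
  "dfun (\<i> * of_real \<tau>) + dfun (- (\<i> * of_real \<tau>)) = of_real (2 * Re (dfun (\<i> * of_real \<tau>)))"
  using cnj_dfun[of "\<i> * of_real \<tau>"] complex_add_cnj[of "dfun (\<i> * of_real \<tau>)"] by simp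

lemma Re_dfun_imaginary:
  "3 * Re (dfun (\<i> * of_real \<tau>)) = cos \<tau>
     - cos (\<tau> / 2) * cosh (sqrt 3 * \<tau> / 2) - sqrt 3 * (sin (\<tau> / 2) * sinh (sqrt 3 * \<tau> / 2))"
  by (simp add: dfun_eq zeta_def Re_exp Im_exp cosh_def sinh_def field_simps)

lemma Delta0_eq_0_iff:
  assumes "0 < l" "t \<noteq> 0"
  shows "Delta0 l (of_real t) = 0 \<longleftrightarrow> Re (dfun (\<i> * of_real (t * l))) = 0"
proof -
  have "Delta0 l (of_real t) = of_real (2 * Re (dfun (\<i> * of_real (t * l)))) / (of_real t)^2"
    using assms char_function_imaginary[of "t * l"] unfolding Delta0_def Delta0_raw_def char_identity
    by (simp add: mult.assoc)
  then show ?thesis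
    using assms by simp
qed

text \<open>At these points the sine term vanishes, and \<open>cosh\<close> of a positive number
  exceeds 1, which makes the parity of \<open>n\<close> decide the sign.\<close>

lemma Re_dfun_2pi_multiple:
  assumes "0 < n"
  shows "if even n then Re (dfun (\<i> * of_real (2 * pi * real n))) < 0
         else 0 < Re (dfun (\<i> * of_real (2 * pi * real n)))"
proof -
  have "sin (pi * real n) = 0"
    by simp
  moreover have "cos (pi * real n) = (-1)^n"
    by (simp add: mult.commute)
  moreover have "cos (2 * pi * real n) = 1"
    by (metis cos_2npi mult.assoc mult.commute)
  ultimately have "3 * Re (dfun (\<i> * of_real (2 * pi * real n))) = 1 - (-1)^n * cosh (sqrt 3 * (pi * real n))"
    using Re_dfun_imaginary[of "2 * pi * real n"] by (simp add: mult.assoc)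
  moreover have "1 < cosh (sqrt 3 * (pi * real n))"
    using assms cosh_real_strict_mono[of 0 "sqrt 3 * (pi * real n)"] by simp
  ultimately show ?thesis
    by (cases "even n") auto
qed

text \<open>Intermediate values between 2 pi n and 2 pi (n + 1); parity only decides which end is
  the positive one.\<close>

lemma Re_dfun_zero_between:
  assumes "0 < n"
  shows "\<exists>\<tau>. 2 * pi * real n \<le> \<tau> \<and> Re (dfun (\<i> * of_real \<tau>)) = 0"
proof -
  have "continuous_on UNIV (\<lambda>\<tau>. Re (dfun (\<i> * of_real \<tau>)))"
    unfolding dfun_eq by (intro continuous_intros) auto
  then have c: "isCont (\<lambda>\<tau>. Re (dfun (\<i> * of_real \<tau>))) x" for x
    by (simp add: continuous_on_eq_continuous_at)
  have le: "2 * pi * real n \<le> 2 * pi * real (Suc n)"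
    by simp
  show ?thesis
  proof (cases "even n")
    case True
    then have "Re (dfun (\<i> * of_real (2 * pi * real n))) \<le> 0"
      "0 \<le> Re (dfun (\<i> * of_real (2 * pi * real (Suc n))))"
      using Re_dfun_2pi_multiple[OF assms] Re_dfun_2pi_multiple[of "Suc n"]
      by (auto simp del: of_nat_Suc split: if_splits)
    from IVT[OF this le] c show ?thesis
      by blast
  next
    case False
    then have "Re (dfun (\<i> * of_real (2 * pi * real (Suc n)))) \<le> 0"
      "0 \<le> Re (dfun (\<i> * of_real (2 * pi * real n)))"
      using Re_dfun_2pi_multiple[OF assms] Re_dfun_2pi_multiple[of "Suc n"]
      by (auto simp del: of_nat_Suc split: if_splits)
    from IVT2[OF this le] c show ?thesis
      by blast
  qed
qed

lemma infinite_zeros: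
  assumes "0 < l"
  shows "infinite {t. 0 < t \<and> Delta0 l (complex_of_real t) = 0}" (is "infinite ?Z")
proof
  assume "finite ?Z"
  then have "bdd_above ?Z"
    by (rule bdd_above_finite)
  then obtain M where M: "\<forall>t\<in>?Z. t \<le> M"
    unfolding bdd_above_def by (elim exE)
  \<comment> \<open>Large enough that the zero found beyond 2 pi n is positive and, divided by
    \<open>l\<close>, exceeds the supposed bound \<open>M\<close>.\<close>
  obtain n :: nat where n: "max 1 (l * M) < real n"
    using reals_Archimedean2 by blast
  then have "0 < n"
    using of_nat_0_less_iff[of n, where 'a=real] by linarith
  then obtain \<tau> where \<tau>: "2 * pi * real n \<le> \<tau>" "Re (dfun (\<i> * of_real \<tau>)) = 0"
    using Re_dfun_zero_between by blast
  have "1 * real n \<le> (2 * pi) * real n"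
    using pi_gt3 by (intro mult_right_mono) auto
  then have lt: "l * M < \<tau>" "0 < \<tau>"
    using \<tau>(1) n by linarith+
  have "\<tau> / l \<in> ?Z"
    using \<tau>(2) lt assms Delta0_eq_0_iff[of l "\<tau> / l"] by simp
  with M have "\<tau> / l \<le> M"
    by blast
  with lt(1) assms show False
    by (simp add: field_simps)
qed

text \<open>A nonconstant entire function has finitely many zeros in a compact disc.\<close>

lemma finite_zeros_below:
  assumes "0 < l"
  shows "finite ({t. 0 < t \<and> Delta0 l (complex_of_real t) = 0} \<inter> {..M})"
proof -
  \<comment> \<open>The characteristic function without its denominator, hence entire, with the same
    positive zeros.\<close>
  define F where "F = (\<lambda>z. dfun (\<i> * (of_real l * z)) + dfun (- (\<i> * (of_real l * z))))"
  have hol: "F holomorphic_on UNIV"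
    unfolding F_def dfun_eq by (intro holomorphic_intros) auto
  have F: "F (of_real t) = of_real (2 * Re (dfun (\<i> * of_real (t * l))))" for t
    using char_function_imaginary[of "t * l"] by (simp add: F_def mult.commute)
  have "F (of_real (2 * pi / l)) \<noteq> 0"
    using F[of "2 * pi / l"] Re_dfun_2pi_multiple[of 1] assms by simp
  moreover have "F 0 = 0"
    by (simp add: F_def exp_sums_0)
  ultimately have "\<not> F constant_on UNIV"
    unfolding constant_on_def by (metis UNIV_I)
  then have "finite {z \<in> cball 0 M. F z = 0}"
    by (rule holomorphic_compact_finite_zeros[OF hol open_UNIV connected_UNIV compact_cball subset_UNIV])
  moreover have "complex_of_real ` ({t. 0 < t \<and> Delta0 l (complex_of_real t) = 0} \<inter> {..M})
      \<subseteq> {z \<in> cball 0 M. F z = 0}"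
    using assms by (auto simp: F Delta0_eq_0_iff)
  ultimately have "finite (complex_of_real ` ({t. 0 < t \<and> Delta0 l (complex_of_real t) = 0} \<inter> {..M}))"
    by (rule rev_finite_subset)
  then show ?thesis
    by (rule finite_imageD) (auto simp: inj_on_def)
qed

text \<open>Finiteness below every bound makes \<open>Z\<close> well-ordered, and infinitude leaves
  elements above every real; iterating the next-element map from the minimum lists
  \<open>Z\<close>.\<close>

lemma strict_mono_enumeration:
  fixes Z :: "real set"
  assumes inf: "infinite Z" and fin: "\<And>M. finite (Z \<inter> {..M})"
  shows "\<exists>f :: nat \<Rightarrow> real. strict_mono f \<and> range f = Z"
proof -
  have least: "\<exists>t\<in>Y. \<forall>s\<in>Y. t \<le> s" if Y: "Y \<subseteq> Z" "Y \<noteq> {}" for Y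
  proof -
    obtain u where u: "u \<in> Y"
      using Y by blast
    have fY: "finite (Y \<inter> {..u})"
      using fin[of u] by (rule rev_finite_subset) (use Y in auto)
    have ne: "Y \<inter> {..u} \<noteq> {}"
      using u by auto
    have "Min (Y \<inter> {..u}) \<in> Y \<inter> {..u}"
      by (rule Min_in[OF fY ne])
    moreover have "Min (Y \<inter> {..u}) \<le> s" if "s \<in> Y" for s
      using Min_le[OF fY, of s] Min_le[OF fY, of u] u that by (cases "s \<le> u") auto
    ultimately show ?thesis
      by blast
  qed
  have above: "Z \<inter> {t<..} \<noteq> {}" for t
  proof
    assume "Z \<inter> {t<..} = {}"
    then have "Z \<inter> {..t} = Z"
      by force
    then show False
      using inf fin[of t] by simp
  qed
  have "\<exists>n. n \<in> Z \<inter> {t<..} \<and> (\<forall>s\<in>Z \<inter> {t<..}. n \<le> s)" for t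
    using least[OF _ above[of t]] by auto
  then obtain succ where succ: "\<And>t. succ t \<in> Z" "\<And>t. t < succ t"
    "\<And>t s. s \<in> Z \<Longrightarrow> t < s \<Longrightarrow> succ t \<le> s"
    by (metis IntD1 IntD2 IntI greaterThan_iff)
  obtain t0 where t0: "t0 \<in> Z" "\<And>s. s \<in> Z \<Longrightarrow> t0 \<le> s"
    using least[of Z] inf by fastforce
  define f where "f n = (succ ^^ n) t0" for n
  have f_Suc: "f (Suc n) = succ (f n)" for n
    by (simp add: f_def)
  have mono: "strict_mono f"
    by (simp add: strict_mono_Suc_iff f_Suc succ)
  have fZ: "f n \<in> Z" for n
    by (cases n) (auto simp: f_Suc succ, simp add: f_def t0)
  moreover have "s \<in> range f" if s: "s \<in> Z" for s
  proof (rule ccontr)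
    assume no: "s \<notin> range f"
    \<comment> \<open>A missed \<open>s\<close> would lie above every \<open>f n\<close>, placing
      the infinite range of \<open>f\<close> inside the finite set
      \<open>Z \<inter> {..s}\<close>.\<close>
    have "f n < s" for n
    proof (induction n)
      case 0
      have "f 0 \<le> s"
        using t0(2)[OF s] by (simp add: f_def)
      then show ?case
        using no by (metis order_le_less rangeI)
    next
      case (Suc n)
      then have "f (Suc n) \<le> s"
        using succ(3)[OF s] by (simp add: f_Suc)
      then show ?case
        using no by (metis order_le_less rangeI)
    qed
    then have "range f \<subseteq> Z \<inter> {..s}"
      using fZ by (auto intro: less_imp_le)
    then have "finite (range f)"
      using fin finite_subset by blast
    then show False
      using strict_mono_imp_inj_on[OF mono] finite_imageD infinite_UNIV_nat by blast
  qed
  ultimately show ?thesis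
    using mono by blast
qed

section \<open>The spectrum\<close>

lemma sfun_cfun_nontrivial:
  assumes "\<tau> \<noteq> 0"
  shows "sfun (\<i> * of_real \<tau>) \<noteq> 0 \<or> cfun (\<i> * of_real \<tau>) \<noteq> 1"
proof (rule ccontr)
  assume "\<not> ?thesis"
  then have sc: "sfun (\<i> * of_real \<tau>) = 0" "cfun (\<i> * of_real \<tau>) = 1"
    by auto
  define z d where "z = \<i> * complex_of_real \<tau>" "d = dfun z"
  have e: "exp z = 1 + d" "exp (z * zeta 2) = 1 + zeta 3 * d" "exp (z * zeta 3) = 1 + zeta 2 * d"
    using exp_zeta_eq[of z] sc by (simp_all add: z_d_def)
  \<comment> \<open>The product of the three exponentials is 1, while here it collapses to
    \<open>1 + d^3\<close>; this forces \<open>d = 0\<close>.\<close>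
  have "(1 + d) * (1 + zeta 3 * d) * (1 + zeta 2 * d)
      = 1 + (1 + zeta 2 + zeta 3) * d + (zeta 2 * zeta 3 + zeta 2 + zeta 3) * d^2 + (zeta 2 * zeta 3) * d^3"
    by (simp add: algebra_simps power2_eq_square power3_eq_cube)
  also have "\<dots> = 1 + d^3"
    by (simp add: zeta_relations)
  finally have "d = 0"
    using prod_exp_zeta[of z] unfolding e by simp
  \<comment> \<open>The modulus is the exponential of \<open>- sqrt 3 * \<tau> / 2\<close>, so it
    equals 1 only for \<open>\<tau> = 0\<close>.\<close>
  then have "cmod (exp (z * zeta 2)) = 1"
    using e by simp
  then have "\<tau> * sqrt 3 = 0"
    by (simp add: z_d_def zeta_def)
  then show False
    using assms by simp
qed

section \<open>Eigenvalues t^3 for real nonzero t\<close>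

context
  fixes l t :: real
  assumes l: "0 < l" and t: "t \<noteq> 0"
begin

text \<open>The cube of \<i>t is -\<i>t^3, the coefficient m belonging to the spectral parameter
  t^3. Negative \<open>t\<close> is allowed and accounts for the negative eigenvalues.\<close>

interpretation fundamental_system "(\<i> * of_real t) ^ 3" "\<lambda>x. cfun (\<i> * of_real t * of_real x)"
  "\<lambda>x. sfun (\<i> * of_real t * of_real x) / (\<i> * of_real t)"
  "\<lambda>x. dfun (\<i> * of_real t * of_real x) / (\<i> * of_real t) ^ 2" l
  by (rule fundamental_system_exp) (use l t in auto)

lemma char_value_eq_0_iff: "char_value = 0 \<longleftrightarrow> Re (dfun (\<i> * of_real (t * l))) = 0"
proof -
  have "char_value = (sfun (\<i> * of_real t * of_real l) ^ 2 + dfun (\<i> * of_real t * of_real l)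
      * (1 - cfun (\<i> * of_real t * of_real l))) / (\<i> * of_real t)^2"
    unfolding char_value_def power_divide add_divide_distrib by simp
  also have "\<dots> = of_real (2 * Re (dfun (\<i> * of_real (t * l)))) / (\<i> * of_real t)^2"
    using char_function_imaginary[of "t * l"] unfolding char_identity by (simp add: mult.assoc)
  finally have "char_value = of_real (2 * Re (dfun (\<i> * of_real (t * l)))) / (\<i> * of_real t)^2" .
  then show ?thesis
    using t by simp
qed

lemma imaginary_cube: "(\<i> * of_real t) ^ 3 = - \<i> * complex_of_real (t ^ 3)"
proof -
  have "\<i> ^ 3 = - \<i>"
    by (simp add: power3_eq_cube)
  then show ?thesis
    by (simp add: power_mult_distrib)
qed

lemma spec_L0_iff: "complex_of_real (t ^ 3) \<in> spec_L0 l \<longleftrightarrow> Re (dfun (\<i> * of_real (t * l))) = 0"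
  unfolding spec_L0_def using resolvent_iff[OF imaginary_cube] char_value_eq_0_iff by simp

lemma eigfun_eq:
  "eigfun l t = (\<lambda>x. (\<i> * of_real t)^2 *
     (sfun (\<i> * of_real t * of_real l) / (\<i> * of_real t) * (sfun (\<i> * of_real t * of_real x) / (\<i> * of_real t))
      + (1 - cfun (\<i> * of_real t * of_real l)) * (dfun (\<i> * of_real t * of_real x) / (\<i> * of_real t) ^ 2)))"
  using t by (auto simp: eigfun_def field_simps power2_eq_square)

lemma eigfun_coefficients_nontrivial:
  "sfun (\<i> * of_real t * of_real l) / (\<i> * of_real t) \<noteq> 0 \<or> cfun (\<i> * of_real t * of_real l) \<noteq> 1"
  using sfun_cfun_nontrivial[of "t * l"] l t by (simp add: mult.assoc)

lemma eigfun_properties: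
  assumes zero: "Re (dfun (\<i> * of_real (t * l))) = 0"
  shows "is_L0 l (eigfun l t) (\<lambda>x. complex_of_real (t^3) * eigfun l t x)"
    and "\<exists>x\<in>{0..l}. eigfun l t x \<noteq> 0"
    and "0 < L2norm l (eigfun l t)"
proof -
  have a: "(\<i> * complex_of_real t)^2 \<noteq> 0"
    using t by simp
  note ef = eigenfunction[OF imaginary_cube char_value_eq_0_iff[THEN iffD2, OF zero] eigfun_coefficients_nontrivial a]
  show "is_L0 l (eigfun l t) (\<lambda>x. complex_of_real (t^3) * eigfun l t x)"
    unfolding eigfun_eq by (rule ef(1))
  show nz: "\<exists>x\<in>{0..l}. eigfun l t x \<noteq> 0"
    unfolding eigfun_eq by (rule ef(3))
  have "continuous_on {0..l} (eigfun l t)"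
    unfolding eigfun_eq by (rule ef(2))
  then have "L2norm l (eigfun l t) \<noteq> 0"
    using L2norm_eq_0_iff_continuous[OF l] nz by blast
  then show "0 < L2norm l (eigfun l t)"
    using L2norm_nonneg[of l "eigfun l t"] by linarith
qed

lemma eigfun_unique:
  assumes "is_L0 l y (\<lambda>x. complex_of_real (t^3) * y x)"
  shows "\<exists>c. \<forall>x\<in>{0..l}. y x = c * eigfun l t x"
proof -
  obtain c where c: "\<forall>x\<in>{0..l}. y x = c *
     (sfun (\<i> * of_real t * of_real l) / (\<i> * of_real t) * (sfun (\<i> * of_real t * of_real x) / (\<i> * of_real t))
      + (1 - cfun (\<i> * of_real t * of_real l)) * (dfun (\<i> * of_real t * of_real x) / (\<i> * of_real t) ^ 2))"
    using eigenfunction_unique[OF imaginary_cube assms eigfun_coefficients_nontrivial] by blast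
  have "\<forall>x\<in>{0..l}. y x = (c / (\<i> * of_real t)^2) * eigfun l t x"
    unfolding eigfun_eq using c t by (simp add: mult.assoc[symmetric])
  then show ?thesis
    by blast
qed

end

text \<open>At 0 the polynomial system has determinant \<open>l^2\<close>, which excludes 0. Reality
  is settled for complex parameters first, so that the theorem can take a real cube root.\<close>

lemma spec_L0_real:
  assumes l: "0 < l" and \<mu>: "\<mu> \<in> spec_L0 l"
  shows "\<mu> \<noteq> 0" and "\<mu> \<in> \<real>"
proof -
  show nz: "\<mu> \<noteq> 0"
  proof
    assume 0: "\<mu> = 0"
    interpret fundamental_system 0 "\<lambda>_. 1" of_real "\<lambda>x. (of_real x)^2 / 2" l
      by (rule fundamental_system_0[OF l])
    have "char_value \<noteq> 0"
      using l by (simp add: char_value_def)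
    then show False
      using resolvent_iff[of 0] \<mu> by (simp add: 0 spec_L0_def)
  qed
  \<comment> \<open>Any complex cube root of \<open>- \<i> * \<mu>\<close> will do; writing it as an
    exponential makes it visibly nonzero.\<close>
  define \<kappa> where "\<kappa> = exp (Ln (- \<i> * \<mu>) / 3)"
  have cube: "\<kappa> ^ 3 = - \<i> * \<mu>"
    using nz by (simp add: \<kappa>_def flip: exp_of_nat_mult)
  interpret fundamental_system "\<kappa> ^ 3" "\<lambda>x. cfun (\<kappa> * of_real x)"
    "\<lambda>x. sfun (\<kappa> * of_real x) / \<kappa>" "\<lambda>x. dfun (\<kappa> * of_real x) / \<kappa> ^ 2" l
    by (rule fundamental_system_exp) (use l in \<open>auto simp: \<kappa>_def\<close>)
  have "char_value = 0"
    using resolvent_iff[OF cube] \<mu> by (simp add: spec_L0_def)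
  then show "\<mu> \<in> \<real>"
    by (rule char_value_0_imp_real[OF cube])
qed

theorem theorem1p1:
  fixes l :: real
  assumes "0 < l"
  shows "\<exists>lam :: nat \<Rightarrow> real.
     strict_mono lam
   \<and> range lam = {t. 0 < t \<and> Delta0 l (complex_of_real t) = 0}
   \<and> spec_L0 l = {\<mu>. \<exists>k. \<mu> = complex_of_real ((lam k)^3) \<or> \<mu> = complex_of_real (- ((lam k)^3))}
   \<and> (\<forall>k. \<forall>t\<in>{lam k, - lam k}.
          is_L0 l (eigfun l t) (\<lambda>x. complex_of_real (t^3) * eigfun l t x)
        \<and> (\<exists>x\<in>{0..l}. eigfun l t x \<noteq> 0)
        \<and> 0 < L2norm l (eigfun l t)
        \<and> (\<forall>y. is_L0 l y (\<lambda>x. complex_of_real (t^3) * y x) \<longrightarrow>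
               (\<exists>c. \<forall>x\<in>{0..l}. y x = c * eigfun l t x)))"
proof -
  note l = assms
  obtain lam :: "nat \<Rightarrow> real" where mono: "strict_mono lam"
    and range: "range lam = {t. 0 < t \<and> Delta0 l (complex_of_real t) = 0}"
    using strict_mono_enumeration[OF infinite_zeros[OF l] finite_zeros_below[OF l]] by blast
  \<comment> \<open>Changing the sign of \<open>t\<close> conjugates \<open>dfun\<close> and keeps
    its real part, so zeros come in pairs of opposite sign.\<close>
  have even: "Re (dfun (\<i> * of_real (- t * l))) = Re (dfun (\<i> * of_real (t * l)))" for t
    using cnj_dfun[of "\<i> * of_real (t * l)"] by (simp add: complex_eq_iff)
  have pos: "0 < lam k" and zero: "Re (dfun (\<i> * of_real (lam k * l))) = 0" for k
  proof -
    have k: "lam k \<in> {t. 0 < t \<and> Delta0 l (complex_of_real t) = 0}"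
      unfolding range[symmetric] by blast
    then show "0 < lam k"
      by blast
    then show "Re (dfun (\<i> * of_real (lam k * l))) = 0"
      using k Delta0_eq_0_iff[OF l, of "lam k"] by simp
  qed
  have pm: "t \<noteq> 0" "Re (dfun (\<i> * of_real (t * l))) = 0" if "t \<in> {lam k, - lam k}" for t k
    using that pos[of k] zero[of k] even[of "lam k"] by auto
  have lamE: "\<exists>k. t = lam k \<or> t = - lam k"
    if "t \<noteq> 0" "Re (dfun (\<i> * of_real (t * l))) = 0" for t
  proof -
    have "Re (dfun (\<i> * of_real (\<bar>t\<bar> * l))) = 0"
      using that(2) even[of t] by (simp add: abs_if)
    then have "\<bar>t\<bar> \<in> range lam"
      unfolding range using that(1) Delta0_eq_0_iff[OF l, of "\<bar>t\<bar>"] by simp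
    then obtain k where "\<bar>t\<bar> = lam k"
      by blast
    then show ?thesis
      by (intro exI[of _ k]) (auto simp: abs_if split: if_splits)
  qed
  have "spec_L0 l = {\<mu>. \<exists>k. \<mu> = complex_of_real ((lam k)^3) \<or> \<mu> = complex_of_real (- ((lam k)^3))}"
    (is "_ = ?R")
  proof (intro set_eqI iffI)
    fix \<mu> assume \<mu>: "\<mu> \<in> spec_L0 l"
    obtain r where r: "\<mu> = complex_of_real r"
      using spec_L0_real(2)[OF l \<mu>] by (auto elim: Reals_cases)
    \<comment> \<open>The real cube root keeps the sign of \<open>r\<close>, so positive and
      negative spectral points are handled at once.\<close>
    define t where "t = root 3 r"
    have rt: "r = t^3" and t: "t \<noteq> 0"
      using spec_L0_real(1)[OF l \<mu>] r by (auto simp: t_def odd_real_root_pow)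
    then have "Re (dfun (\<i> * of_real (t * l))) = 0"
      using spec_L0_iff[OF l t] \<mu> r by simp
    then obtain k where "t = lam k \<or> t = - lam k"
      using lamE[OF t] by blast
    then show "\<mu> \<in> ?R"
      unfolding r rt by (auto intro!: exI[of _ k])
  next
    fix \<mu> assume "\<mu> \<in> ?R"
    then obtain k where "\<mu> = complex_of_real ((lam k)^3) \<or> \<mu> = complex_of_real ((- lam k)^3)"
      by auto
    then obtain t where t: "t \<in> {lam k, - lam k}" "\<mu> = complex_of_real (t^3)"
      by blast
    then show "\<mu> \<in> spec_L0 l"
      using spec_L0_iff[OF l pm(1)[OF t(1)]] pm(2)[OF t(1)] by simp
  qed
  moreover have "is_L0 l (eigfun l t) (\<lambda>x. complex_of_real (t^3) * eigfun l t x)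
        \<and> (\<exists>x\<in>{0..l}. eigfun l t x \<noteq> 0)
        \<and> 0 < L2norm l (eigfun l t)
        \<and> (\<forall>y. is_L0 l y (\<lambda>x. complex_of_real (t^3) * y x) \<longrightarrow>
               (\<exists>c. \<forall>x\<in>{0..l}. y x = c * eigfun l t x))" if "t \<in> {lam k, - lam k}" for t k
    using eigfun_properties[OF l pm[OF that]] eigfun_unique[OF l pm(1)[OF that]] by blast
  ultimately show ?thesis
    using mono range by blast
qed

end
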